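(* Let $\alpha>0$ be a constant, $m=n^{\alpha}$, and let $p=p(n)\in[0,1]$ satisfy $mp^2<1$. Let $\mathcal{A}$ be an increasing graph property. Suppose that either $np=o(1)$ or $np\to\infty$, and let $$ \hat{p}_-= \begin{cases} mp^2\left(1-(n-2)p-\dfrac{mp^2}{2}\right), & \text{for } np=o(1);\\[3mm] \dfrac{mp}{n}\left(1-\dfrac{\omega}{\sqrt{mnp}}-\dfrac{2}{np}-\dfrac{mp}{2n}\right), & \text{for } np\to\infty \text{ and some } \omega=\omega(n)\to\infty,\ \omega=o(\sqrt{mnp}). \end{cases} $$ If $$ \Pr\{G(n,\hat{p}_-)\in\mathcal{A}\}\to 1 \quad (n\to\infty), $$ then $$ \Pr\{\mathcal{G}(n,m,p)\in\mathcal{A}\}\to 1 \quad (n\to\infty). $$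
   Context: $G(n,\hat{p})$ is the random graph on a set $\mathcal{V}$ of $n$ vertices in which each edge appears independently with probability $\hat{p}$. The random intersection graph $\mathcal{G}(n,m,p)$ is defined as follows. Let $\mathcal{V}$ be a set of $n$ vertices and $\mathcal{W}$ an auxiliary set of $m$ features. Each vertex $v\in\mathcal{V}$ is assigned a random subset $W_v\subseteq\mathcal{W}$, where each feature $w\in\mathcal{W}$ belongs to $W_v$ with probability $p$, independently over all pairs $(v,w)$. Two distinct vertices $v_1,v_2$ are adjacent if and only if $W_{v_1}\cap W_{v_2}\neq\emptyset$. For the family $\mathcal{G}$ of graphs with vertex set $\mathcal{V}$, a subset $\mathcal{A}\subseteq\mathcal{G}$ is an increasing property if $\mathcal{A}$ is closed under isomorphism and $G\in\mathcal{A}$ implies $G'\in\mathcal{A}$ for all $G'\in\mathcal{G}$ with $E(G)\subseteq E(G')$ (one such $\mathcal{A}$ is given for each $n$). All limits and $o(\cdot)$ are as $n\to\infty$; $a_n=o(b_n)$ means $a_n/b_n\to0$. *)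

theory Defs
  imports "HOL-Probability.Probability" "HOL-Library.Landau_Symbols"
begin

text \<open>
  A simple graph on a given vertex set \<open>V\<close> is represented by its edge set, a set of
  two-element subsets of \<open>V\<close>.
\<close>

definition all_edges :: "'v set \<Rightarrow> 'v set set" where
  "all_edges V = {e. e \<subseteq> V \<and> card e = 2}"

definition graphs_on :: "'v set \<Rightarrow> 'v set set set" where
  "graphs_on V = Pow (all_edges V)"

definition graph_iso :: "'v set \<Rightarrow> 'v set set \<Rightarrow> 'v set set \<Rightarrow> bool" where
  "graph_iso V E E' \<longleftrightarrow>
     (\<exists>f. bij_betw f V V \<and> (\<forall>u\<in>V. \<forall>v\<in>V. {u, v} \<in> E \<longleftrightarrow> {f u, f v} \<in> E'))"

definition increasing_property :: "'v set \<Rightarrow> 'v set set set \<Rightarrow> bool" where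
  "increasing_property V A \<longleftrightarrow>
     A \<subseteq> graphs_on V \<and>
     (\<forall>E\<in>A. \<forall>E'\<in>graphs_on V. graph_iso V E E' \<longrightarrow> E' \<in> A) \<and>
     (\<forall>E\<in>A. \<forall>E'\<in>graphs_on V. E \<subseteq> E' \<longrightarrow> E' \<in> A)"

text \<open>
  The random graphs are distributions on edge sets, meaningful for finite \<open>V\<close> and \<open>W\<close>
  only. Note that \<^const>\<open>bernoulli_pmf\<close> truncates its parameter to the unit interval, so
  an edge probability outside of it is read as 0 or 1.
\<close>

definition binomial_graph :: "'v set \<Rightarrow> real \<Rightarrow> 'v set set pmf" where
  "binomial_graph V q =
     map_pmf (\<lambda>b. {e \<in> all_edges V. b e})
       (Pi_pmf (all_edges V) False (\<lambda>_. bernoulli_pmf q))"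

definition intersection_graph :: "'v set \<Rightarrow> ('v \<Rightarrow> 'w set) \<Rightarrow> 'v set set" where
  "intersection_graph V S =
     {{u, v} | u v. u \<in> V \<and> v \<in> V \<and> u \<noteq> v \<and> S u \<inter> S v \<noteq> {}}"

definition random_intersection_graph :: "'v set \<Rightarrow> 'w set \<Rightarrow> real \<Rightarrow> 'v set set pmf" where
  "random_intersection_graph V W p =
     map_pmf (\<lambda>b. intersection_graph V (\<lambda>v. {w \<in> W. b (v, w)}))
       (Pi_pmf (V \<times> W) False (\<lambda>_. bernoulli_pmf p))"

end

theory Submission
  imports Defs
begin

text \<open>
  A feature chosen by \<open>x\<close> vertices makes them a clique, and this clique contains \<open>x div 2\<close>
  independent uniform edges: draw the edges first and extend the set they cover to a uniform
  \<open>x\<close>-subset. Hence the intersection graph can be coupled so as to contain \<open>M\<close> independent uniform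
  edges, where \<open>M\<close> is the sum of the numbers \<open>x div 2\<close> over all features, whereas a Poisson number of
  independent uniform edges is a binomial random graph. So it is enough to compare \<open>M\<close> with a Poisson
  variable, and failure probabilities may be lost up to a constant factor.

  If \<open>n p \<rightarrow> 0\<close>, then \<open>M\<close> is at least the number of features chosen at least twice, which
  is \<open>Bin(m, q)\<close> with \<open>q \<rightarrow> 0\<close>. The weights of \<open>Bin(m, q)\<close> are at most 8 times
  those of \<open>Po(m q)\<close>, so no bound on their distance is needed. If \<open>n p \<rightarrow> \<infinity>\<close>,
  exponential moment bounds separate \<open>M\<close> from a Poisson variable whose mean is smaller by a multiple of
  \<open>\<omega> sqrt (m n p)\<close>.
\<close>

subsection \<open>Independent uniform edges\<close>

lemma prob_bind_pmf:
  "measure_pmf.prob (bind_pmf p f) X = measure_pmf.expectation p (\<lambda>x. measure_pmf.prob (f x) X)"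
proof -
  have "ennreal (measure_pmf.prob (bind_pmf p f) X) = (\<integral>\<^sup>+x. ennreal (measure_pmf.prob (f x) X) \<partial>p)"
    by (simp add: measure_pmf.emeasure_eq_measure[symmetric])
  also have "\<dots> = ennreal (measure_pmf.expectation p (\<lambda>x. measure_pmf.prob (f x) X))"
    by (intro nn_integral_eq_integral measure_pmf.integrable_const_bound[where B = 1]) auto
  finally show ?thesis
    by (simp add: integral_nonneg_AE)
qed

lemma finite_all_edges [simp]: "finite V \<Longrightarrow> finite (all_edges V)"
  by (simp add: all_edges_def)

lemma card_all_edges: "finite V \<Longrightarrow> card (all_edges V) = card V choose 2"
  by (simp add: all_edges_def n_subsets)

lemma all_edges_nonempty:
  assumes "finite V" "2 \<le> card V"
  shows "all_edges V \<noteq> {}"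
  using assms card_all_edges[of V] by (auto simp: binomial_eq_0_iff)

text \<open>Edges are drawn with replacement, so fewer than \<open>k\<close> distinct ones may
  result. Independence of the draws is what allows samples to be concatenated and a Poisson number
  of draws to give a binomial random graph.\<close>

primrec random_edges :: "'v set \<Rightarrow> nat \<Rightarrow> 'v set set pmf" where
  "random_edges V 0 = return_pmf {}"
| "random_edges V (Suc k) =
     bind_pmf (pmf_of_set (all_edges V)) (\<lambda>e. map_pmf (insert e) (random_edges V k))"

lemma random_edges_add:
  "random_edges V (k + l) =
     bind_pmf (random_edges V k) (\<lambda>S. map_pmf ((\<union>) S) (random_edges V l))"
proof (induction k)
  case 0
  have "(\<union>) {} = (\<lambda>S. S :: 'a set set)"
    by auto
  then show ?case
    by (simp add: bind_return_pmf)
qed (simp add: bind_return_pmf bind_assoc_pmf bind_map_pmf map_bind_pmf pmf.map_comp o_def Un_insert_left[abs_def])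

text \<open>The bound on the covered vertices leaves room to extend them to a vertex set of any size
  from \<open>2 * k\<close> to \<open>card V\<close>.\<close>

lemma set_pmf_random_edges:
  assumes "finite V" "2 \<le> card V" "S \<in> set_pmf (random_edges V k)"
  shows "S \<subseteq> all_edges V" "card (\<Union>S) \<le> 2 * k"
proof -
  have "S \<subseteq> all_edges V \<and> card (\<Union>S) \<le> 2 * k"
    using assms(3)
  proof (induction k arbitrary: S)
    case (Suc k)
    then obtain e S' where S': "e \<in> all_edges V" "S' \<in> set_pmf (random_edges V k)" "S = insert e S'"
      using assms all_edges_nonempty[of V] by auto
    then have "S' \<subseteq> all_edges V" "card (\<Union>S') \<le> 2 * k" "card e = 2"
      using Suc.IH by (auto simp: all_edges_def)
    moreover have "card (e \<union> \<Union>S') \<le> card e + card (\<Union>S')"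
      by (rule card_Un_le)
    ultimately show ?case
      using S' by auto
  qed simp
  then show "S \<subseteq> all_edges V" "card (\<Union>S) \<le> 2 * k"
    by auto
qed

lemma bij_betw_image_all_edges:
  assumes "bij_betw f V V"
  shows "bij_betw ((`) f) (all_edges V) (all_edges V)"
proof -
  have "bij_betw ((`) f) (Pow V) (Pow V)"
    using assms by (rule bij_betw_Pow)
  moreover have "card (f ` e) = card e" if "e \<subseteq> V" for e
    using assms that by (meson bij_betw_def card_image inj_on_subset)
  ultimately show ?thesis
    using bij_betw_Collect[of "(`) f" "Pow V" "Pow V" "\<lambda>e. card e = 2" "\<lambda>e. card e = 2"]
    by (simp add: all_edges_def)
qed

text \<open>A permutation of \<open>V\<close> permutes the edges, so each draw, and hence the whole
  sample, keeps its law.\<close>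

lemma map_pmf_random_edges:
  assumes "finite V" "2 \<le> card V" "bij_betw f V V"
  shows "map_pmf ((`) ((`) f)) (random_edges V k) = random_edges V k"
proof (induction k)
  case (Suc k)
  have "map_pmf ((`) ((`) f)) (random_edges V (Suc k)) =
      bind_pmf (map_pmf ((`) f) (pmf_of_set (all_edges V)))
        (\<lambda>e. map_pmf (insert e) (map_pmf ((`) ((`) f)) (random_edges V k)))"
    by (simp add: map_bind_pmf bind_map_pmf pmf.map_comp o_def)
  also have "map_pmf ((`) f) (pmf_of_set (all_edges V)) = pmf_of_set (all_edges V)"
    using assms by (intro map_pmf_of_set_bij_betw bij_betw_image_all_edges all_edges_nonempty) auto
  finally show ?case
    by (simp add: Suc.IH)
qed simp

text \<open>A bijection of the two sets is glued to one of their complements, which also have equal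
  size. Permutations thus act transitively on subsets of a given size, so that an invariant law on
  these is uniform.\<close>

lemma bij_betw_swapping_subsets:
  assumes "finite V" "A \<subseteq> V" "B \<subseteq> V" "card A = card B"
  obtains f where "bij_betw f V V" "f ` A = B"
proof -
  have fin: "finite A" "finite B"
    using assms finite_subset by auto
  obtain g where g: "bij_betw g A B"
    using assms(4) fin finite_same_card_bij by blast
  obtain h where h: "bij_betw h (V - A) (V - B)"
    using assms fin by (metis card_Diff_subset finite_Diff finite_same_card_bij)
  define f where "f = (\<lambda>x. if x \<in> A then g x else h x)"
  have "bij_betw f A B" "bij_betw f (V - A) (V - B)"
    using g h by (auto simp: f_def intro: bij_betw_cong[THEN iffD1])
  then have "bij_betw f (A \<union> (V - A)) (B \<union> (V - B))"
    by (intro bij_betw_combine) auto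
  then have "bij_betw f V V"
    using assms by (simp add: Un_absorb1)
  then show thesis
    using that \<open>bij_betw f A B\<close> by (auto simp: bij_betw_def)
qed

lemma pmf_of_set_eqI:
  assumes "finite F" "set_pmf Q \<subseteq> F" "\<And>x y. x \<in> F \<Longrightarrow> y \<in> F \<Longrightarrow> pmf Q x = pmf Q y"
  shows "Q = pmf_of_set F"
proof (rule pmf_eqI)
  fix x
  have ne: "F \<noteq> {}"
    using assms(2) set_pmf_not_empty[of Q] by auto
  have one: "(\<Sum>y\<in>F. pmf Q y) = 1"
    using assms(1,2) by (rule sum_pmf_eq_1)
  show "pmf Q x = pmf (pmf_of_set F) x"
  proof (cases "x \<in> F")
    case True
    then have "(\<Sum>y\<in>F. pmf Q y) = (\<Sum>y\<in>F. pmf Q x)"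
      by (intro sum.cong refl assms(3))
    then have "real (card F) * pmf Q x = 1"
      using one by simp
    then show ?thesis
      using True assms(1) ne by (simp add: field_simps)
  next
    case False
    then show ?thesis
      using assms(1,2) ne by (auto simp: set_pmf_iff)
  qed
qed

text \<open>The mixture on the left is invariant under permutations of \<open>V\<close>, hence uniform.\<close>
lemma random_edges_extend:
  assumes V: "finite V" "2 \<le> card V" and x: "2 * k \<le> x" "x \<le> card V"
  shows "bind_pmf (random_edges V k)
           (\<lambda>S. pmf_of_set {U. U \<subseteq> V \<and> card U = x \<and> \<Union>S \<subseteq> U}) =
         pmf_of_set {U. U \<subseteq> V \<and> card U = x}" (is "?Q = pmf_of_set ?F")
proof (rule pmf_of_set_eqI)
  define ext where "ext S = {U. U \<subseteq> V \<and> card U = x \<and> \<Union>S \<subseteq> U}" for S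
  have fin: "finite (ext S)" for S
    using V by (auto simp: ext_def)
  have ne: "ext S \<noteq> {}" if "S \<in> set_pmf (random_edges V k)" for S
  proof -
    have "\<Union>S \<subseteq> V" "card (\<Union>S) \<le> 2 * k"
      using set_pmf_random_edges[OF V that] by (auto simp: all_edges_def)
    then have "\<exists>U. \<Union>S \<subseteq> U \<and> U \<subseteq> V \<and> card U = x"
      using exists_subset_between[of "\<Union>S" x V] V x by force
    then show ?thesis
      by (auto simp: ext_def)
  qed
  show "finite ?F"
    using V by auto
  show "set_pmf ?Q \<subseteq> ?F"
    using fin ne by (auto simp: ext_def[symmetric]) (auto simp: ext_def)
  fix A B
  assume AB: "A \<in> ?F" "B \<in> ?F"
  then obtain f where f: "bij_betw f V V" "f ` A = B"
    using bij_betw_swapping_subsets[of V A B] V by auto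
  have im: "bij_betw ((`) f) (ext S) (ext ((`) f ` S))" if "S \<in> set_pmf (random_edges V k)" for S
  proof -
    have sub: "\<Union>S \<subseteq> V"
      using set_pmf_random_edges[OF V that] by (auto simp: all_edges_def)
    have "card (f ` U) = card U" if "U \<subseteq> V" for U
      using f that by (meson bij_betw_def card_image inj_on_subset)
    moreover have "\<Union>((`) f ` S) \<subseteq> f ` U \<longleftrightarrow> \<Union>S \<subseteq> U" if "U \<subseteq> V" for U
      using f(1) sub that inj_on_image_subset_iff[of f V "\<Union>S" U]
      by (simp add: bij_betw_def image_Union[symmetric])
    moreover have "f ` U \<subseteq> V" if "U \<subseteq> V" for U
      using that f(1) by (auto simp: bij_betw_def)
    ultimately have iff: "U \<in> ext S \<longleftrightarrow> f ` U \<in> ext ((`) f ` S)" if "U \<subseteq> V" for U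
      using that by (simp add: ext_def)
    have "bij_betw ((`) f) {U \<in> Pow V. U \<in> ext S} {U \<in> Pow V. U \<in> ext ((`) f ` S)}"
      using bij_betw_Pow[OF f(1)] iff by (intro bij_betw_Collect) auto
    moreover have "{U \<in> Pow V. U \<in> ext S'} = ext S'" for S'
      by (auto simp: ext_def)
    ultimately show ?thesis
      by simp
  qed
  \<comment> \<open>The permutation is moved from the extension to the sampled edges, whose law it
    preserves.\<close>
  have "map_pmf ((`) f) ?Q = bind_pmf (random_edges V k) (\<lambda>S. map_pmf ((`) f) (pmf_of_set (ext S)))"
    by (simp add: map_bind_pmf ext_def)
  also have "\<dots> = bind_pmf (random_edges V k) (\<lambda>S. pmf_of_set (ext ((`) f ` S)))"
    using im ne fin by (intro bind_pmf_cong refl map_pmf_of_set_bij_betw) auto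
  also have "\<dots> = bind_pmf (map_pmf ((`) ((`) f)) (random_edges V k)) (\<lambda>S. pmf_of_set (ext S))"
    by (simp add: bind_map_pmf)
  also have "\<dots> = ?Q"
    by (simp add: map_pmf_random_edges[OF V f(1)] ext_def)
  finally have inv: "map_pmf ((`) f) ?Q = ?Q" .
  have sub: "set_pmf ?Q \<subseteq> Pow V" and inj: "inj_on ((`) f) (Pow V)"
    using \<open>set_pmf ?Q \<subseteq> ?F\<close> bij_betw_Pow[OF f(1)] by (auto simp: bij_betw_def)
  \<comment> \<open>The image map is known to be injective on \<open>Pow V\<close> only; preimages
    outside it have weight 0.\<close>
  have "pmf (map_pmf ((`) f) ?Q) (f ` A) = measure_pmf.prob ?Q {A}"
    unfolding pmf_map
  proof (rule measure_prob_cong_0)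
    fix U assume U: "U \<in> (`) f -` {f ` A} - {A}"
    have "U \<notin> Pow V"
    proof
      assume "U \<in> Pow V"
      then show False
        using inj_onD[OF inj, of U A] U AB by auto
    qed
    then show "pmf ?Q U = 0"
      using sub by (meson in_mono set_pmf_iff)
  qed auto
  then have "pmf (map_pmf ((`) f) ?Q) (f ` A) = pmf ?Q A"
    by (simp add: measure_pmf_single)
  then show "pmf ?Q A = pmf ?Q B"
    using inv f(2) by simp
qed

subsection \<open>Coupling with the intersection graph\<close>

text \<open>The first \<open>k\<close> of \<open>l\<close> draws form a sample of size
  \<open>k\<close>.\<close>

lemma rel_pmf_random_edges_mono:
  assumes "k \<le> l"
  shows "rel_pmf (\<subseteq>) (random_edges V k) (random_edges V l)"
proof -
  have "rel_pmf (\<subseteq>) (bind_pmf (random_edges V k) return_pmf)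
          (bind_pmf (random_edges V k) (\<lambda>S. map_pmf ((\<union>) S) (random_edges V (l - k))))"
    by (rule rel_pmf_bindI[where R = "(=)"])
      (auto simp: pmf.rel_eq rel_pmf_return_pmf1)
  then show ?thesis
    using assms by (simp add: random_edges_add[symmetric] bind_return_pmf')
qed

text \<open>Every extension in \<open>random_edges_extend\<close> contains all vertices of the
  sampled edges, so drawing the edges first and the vertex set second is the coupling
  sought.\<close>

lemma rel_pmf_random_edges_subset:
  assumes V: "finite V" "2 \<le> card V" and x: "2 * k \<le> x" "x \<le> card V"
  shows "rel_pmf (\<lambda>S U. S \<subseteq> all_edges U) (random_edges V k)
           (pmf_of_set {U. U \<subseteq> V \<and> card U = x})"
proof -
  have "S \<subseteq> all_edges U" if "S \<in> set_pmf (random_edges V k)"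
    "U \<in> set_pmf (pmf_of_set {U. U \<subseteq> V \<and> card U = x \<and> \<Union>S \<subseteq> U})" for S U
  proof -
    have S: "S \<subseteq> all_edges V" "card (\<Union>S) \<le> 2 * k"
      using set_pmf_random_edges[OF V that(1)] by auto
    then have "\<Union>S \<subseteq> V"
      by (auto simp: all_edges_def)
    then have "\<exists>U. \<Union>S \<subseteq> U \<and> U \<subseteq> V \<and> card U = x"
      using exists_subset_between[of "\<Union>S" x V] S V x by force
    \<comment> \<open>\<open>pmf_of_set\<close> has the expected support only for a nonempty finite
      set.\<close>
    then have "{U. U \<subseteq> V \<and> card U = x \<and> \<Union>S \<subseteq> U} \<noteq> {}"
      by auto
    then have "\<Union>S \<subseteq> U"
      using that(2) V by auto
    then show ?thesis
      using S by (auto simp: all_edges_def)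
  qed
  then have "rel_pmf (\<lambda>S U. S \<subseteq> all_edges U) (bind_pmf (random_edges V k) return_pmf)
     (bind_pmf (random_edges V k) (\<lambda>S. pmf_of_set {U. U \<subseteq> V \<and> card U = x \<and> \<Union>S \<subseteq> U}))"
    by (intro rel_pmf_bindI[where R = "\<lambda>S S'. S = S' \<and> S \<in> set_pmf (random_edges V k)"] rel_pmf_reflI)
      (auto simp: rel_pmf_return_pmf1)
  then show ?thesis
    by (simp add: random_edges_extend[OF V x] bind_return_pmf')
qed

text \<open>Given its size, the random subset is uniform: the binomial coefficient cancels against
  the number of sets of that size, which leaves the product weight of \<open>U\<close>.\<close>

lemma binomial_subset_conv:
  assumes V: "finite V" and p: "p \<in> {0..1}"
  shows "map_pmf (\<lambda>b. {v \<in> V. b v}) (Pi_pmf V False (\<lambda>_. bernoulli_pmf p)) =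
         bind_pmf (binomial_pmf (card V) p) (\<lambda>x. pmf_of_set {U. U \<subseteq> V \<and> card U = x})"
    (is "?Q = ?Q'")
proof (rule pmf_eqI)
  fix U
  let ?F = "\<lambda>x. {U. U \<subseteq> V \<and> card U = x}"
  have fin: "finite (?F x)" for x
    using V by auto
  have ne: "?F x \<noteq> {}" if "x \<le> card V" for x
    using obtain_subset_with_card_n[OF that] by blast
  have F: "pmf (pmf_of_set (?F x)) U =
      (if U \<subseteq> V \<and> card U = x then 1 / real (card V choose x) else 0)" if "x \<le> card V" for x
    using fin ne[OF that] n_subsets[OF V, of x] by (auto simp: indicator_def)
  have Q': "pmf ?Q' U = (\<Sum>x\<le>card V. real (card V choose x) * p ^ x * (1 - p) ^ (card V - x) *
      (if U \<subseteq> V \<and> card U = x then 1 / real (card V choose x) else 0))"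
    using p by (simp add: pmf_bind expectation_binomial_pmf' F)
  show "pmf ?Q U = pmf ?Q' U"
  proof (cases "U \<subseteq> V")
    case True
    let ?u = "\<lambda>v. v \<in> U"
    have c: "card U \<le> card V"
      using True V by (simp add: card_mono)
    \<comment> \<open>Functions that are true somewhere outside \<open>V\<close> may also map to
      \<open>U\<close>, but they deviate from the default \<open>False\<close> there and have weight
      0.\<close>
    have "pmf ?Q U = measure_pmf.prob (Pi_pmf V False (\<lambda>_. bernoulli_pmf p)) {?u}"
      unfolding pmf_map
    proof (rule measure_prob_cong_0)
      fix b assume "b \<in> (\<lambda>b. {v \<in> V. b v}) -` {U} - {?u}"
      then have "\<exists>v. v \<notin> V \<and> b v"
        by auto
      then show "pmf (Pi_pmf V False (\<lambda>_. bernoulli_pmf p)) b = 0"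
        using V by (auto intro!: pmf_Pi_outside)
    qed (use True in auto)
    also have "\<dots> = (\<Prod>v\<in>V. pmf (bernoulli_pmf p) (?u v))"
      using V True by (subst measure_pmf_single, subst pmf_Pi') auto
    also have "\<dots> = (\<Prod>v\<in>V. if v \<in> U then p else 1 - p)"
      using p by (intro prod.cong) auto
    also have "\<dots> = p ^ card U * (1 - p) ^ (card V - card U)"
      using V True finite_subset[OF True V]
      by (simp add: prod.If_cases Int_absorb1 Diff_eq[symmetric] card_Diff_subset)
    finally have Q: "pmf ?Q U = p ^ card U * (1 - p) ^ (card V - card U)" .
    have "pmf ?Q' U = (\<Sum>x\<le>card V. if x = card U then p ^ x * (1 - p) ^ (card V - x) else 0)"
      unfolding Q' using True by (intro sum.cong) auto
    then show ?thesis
      using Q c by simp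
  next
    case False
    have "U \<notin> set_pmf ?Q"
      using False by auto
    moreover have "pmf ?Q' U = 0"
      unfolding Q' using False by simp
    ultimately show ?thesis
      by (metis pmf_eq_0_set_pmf)
  qed
qed

section \<open>Adding up the contributions of the features\<close>

primrec iid_sum :: "nat pmf \<Rightarrow> nat \<Rightarrow> nat pmf" where
  "iid_sum K 0 = return_pmf 0"
| "iid_sum K (Suc m) = bind_pmf K (\<lambda>x. map_pmf ((+) x) (iid_sum K m))"

text \<open>Splitting off one summand turns the sample into a union of independent parts, which
  matches the recursion of the intersection graph over its features.\<close>

lemma bind_iid_sum_random_edges:
  "bind_pmf (iid_sum K (Suc m)) (random_edges V) =
     bind_pmf (bind_pmf K (random_edges V))
       (\<lambda>S. map_pmf ((\<union>) S) (bind_pmf (iid_sum K m) (random_edges V)))"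
proof -
  have "bind_pmf (iid_sum K (Suc m)) (random_edges V) =
      bind_pmf K (\<lambda>x. bind_pmf (iid_sum K m) (\<lambda>y. bind_pmf (random_edges V x)
        (\<lambda>S. map_pmf ((\<union>) S) (random_edges V y))))"
    by (simp add: bind_assoc_pmf bind_map_pmf random_edges_add)
  \<comment> \<open>The edges of the first summand and the number of later edges are independent, so
    the order of drawing may be exchanged.\<close>
  also have "\<dots> = bind_pmf K (\<lambda>x. bind_pmf (random_edges V x) (\<lambda>S. bind_pmf (iid_sum K m)
        (\<lambda>y. map_pmf ((\<union>) S) (random_edges V y))))"
    by (subst bind_commute_pmf) simp
  finally show ?thesis
    by (simp add: bind_assoc_pmf map_bind_pmf)
qed

lemma intersection_graph_insert:
  "intersection_graph V (\<lambda>v. {w' \<in> insert w W. b (v, w')}) =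
     all_edges {v \<in> V. b (v, w)} \<union> intersection_graph V (\<lambda>v. {w' \<in> W. b (v, w')})"
  by (auto simp: intersection_graph_def all_edges_def card_2_iff)

text \<open>The choices of \<open>w\<close> are independent of those of the other features and enter
  the graph only through the clique of \<open>w\<close>.\<close>

lemma random_intersection_graph_insert:
  assumes "finite V" "finite W" "w \<notin> W"
  shows "random_intersection_graph V (insert w W) p =
    bind_pmf (map_pmf (\<lambda>b. {v \<in> V. b v}) (Pi_pmf V False (\<lambda>_. bernoulli_pmf p)))
      (\<lambda>U. map_pmf ((\<union>) (all_edges U)) (random_intersection_graph V W p))"
proof -
  let ?P = "\<lambda>A. Pi_pmf A False (\<lambda>_. bernoulli_pmf p)"
  let ?IG = "\<lambda>b. intersection_graph V (\<lambda>v. {w' \<in> W. b (v, w')})"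
  have bij: "bij_betw (\<lambda>v. (v, w)) V (V \<times> {w})"
    by (auto simp: bij_betw_def inj_on_def)
  have slice: "map_pmf (\<lambda>b. {v \<in> V. b (v, w)}) (?P (V \<times> {w})) = map_pmf (\<lambda>b. {v \<in> V. b v}) (?P V)"
  proof -
    have "?P V = map_pmf (\<lambda>f. f \<circ> (\<lambda>v. (v, w))) (?P (V \<times> {w}))"
      using assms bij by (intro Pi_pmf_bij_betw) auto
    then show ?thesis
      by (simp add: pmf.map_comp o_def)
  qed
  have IG_cong: "?IG (\<lambda>x. if x \<in> V \<times> {w} then f x else g x) = ?IG g" for f g
    using assms by (auto simp: intersection_graph_def)
  have "V \<times> insert w W = (V \<times> {w}) \<union> (V \<times> W)"
    by auto
  moreover have "?P ((V \<times> {w}) \<union> (V \<times> W)) = map_pmf (\<lambda>(f, g) x. if x \<in> V \<times> {w} then f x else g x)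
      (pair_pmf (?P (V \<times> {w})) (?P (V \<times> W)))"
    using assms by (intro Pi_pmf_union) auto
  ultimately have "random_intersection_graph V (insert w W) p =
      map_pmf (\<lambda>(f, g). all_edges {v \<in> V. f (v, w)} \<union> ?IG g)
      (pair_pmf (?P (V \<times> {w})) (?P (V \<times> W)))"
    unfolding random_intersection_graph_def intersection_graph_insert
    by (simp only: pmf.map_comp o_def) (intro map_pmf_cong refl; simp only: split_beta IG_cong; simp cong: conj_cong)
  also have "\<dots> = bind_pmf (map_pmf (\<lambda>b. {v \<in> V. b (v, w)}) (?P (V \<times> {w})))
      (\<lambda>U. map_pmf ((\<union>) (all_edges U)) (random_intersection_graph V W p))"
    by (simp add: random_intersection_graph_def pair_pmf_def map_pmf_def bind_assoc_pmf bind_return_pmf)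
  finally show ?thesis
    unfolding slice .
qed

text \<open>The features are coupled one at a time; the clique of a feature chosen by
  \<open>x\<close> vertices has room for \<open>g x\<close> independent edges. Leaving
  \<open>g\<close> open serves both regimes, with \<open>of_bool (2 \<le> x)\<close> and with
  \<open>x div 2\<close>.\<close>

lemma rel_pmf_random_intersection_graph:
  assumes V: "finite V" "2 \<le> card V" and W: "finite W" and p: "p \<in> {0..1}"
    and g: "\<And>x. 2 * g x \<le> x"
  shows "rel_pmf (\<subseteq>)
           (bind_pmf (iid_sum (map_pmf g (binomial_pmf (card V) p)) (card W)) (random_edges V))
           (random_intersection_graph V W p)"
  using W
proof (induction W rule: finite_induct)
  case empty
  then show ?case
    by (simp add: bind_return_pmf rel_pmf_return_pmf1)
next
  case (insert w W)
  let ?K = "map_pmf g (binomial_pmf (card V) p)"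
  have "rel_pmf (\<lambda>S U. S \<subseteq> all_edges U) (bind_pmf (binomial_pmf (card V) p) (\<lambda>x. random_edges V (g x)))
       (bind_pmf (binomial_pmf (card V) p) (\<lambda>x. pmf_of_set {U. U \<subseteq> V \<and> card U = x}))"
  proof (rule rel_pmf_bindI[where R = "\<lambda>x y. x = y \<and> x \<le> card V"])
    \<comment> \<open>The relation remembers \<open>x \<le> card V\<close>, without which there is
      no \<open>x\<close>-subset of \<open>V\<close>.\<close>
    show "rel_pmf (\<lambda>x y. x = y \<and> x \<le> card V) (binomial_pmf (card V) p) (binomial_pmf (card V) p)"
      using p by (intro rel_pmf_reflI) (auto simp: set_pmf_binomial_eq split: if_splits)
  qed (auto intro!: rel_pmf_random_edges_subset V g)
  then have single: "rel_pmf (\<lambda>S U. S \<subseteq> all_edges U) (bind_pmf ?K (random_edges V))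
      (map_pmf (\<lambda>b. {v \<in> V. b v}) (Pi_pmf V False (\<lambda>_. bernoulli_pmf p)))"
    using V p by (simp add: bind_map_pmf binomial_subset_conv)
  show ?case
    unfolding card_insert_disjoint[OF insert.hyps] bind_iid_sum_random_edges
      random_intersection_graph_insert[OF V(1) insert.hyps]
    by (rule rel_pmf_bindI[OF single])
      (auto simp: pmf.rel_map intro!: pmf.rel_mono_strong[OF insert.IH])
qed

subsection \<open>Poisson many edges\<close>

text \<open>The weight of \<open>B\<close> is the probability of \<open>Pow B\<close> minus the
  weights of the proper subsets, which agree by induction. Random graphs can thus be compared
  through the probabilities of avoiding all edges outside a given set.\<close>

lemma pmf_eq_if_prob_Pow_eq:
  assumes E: "finite E" and sub: "set_pmf P \<subseteq> Pow E" "set_pmf Q \<subseteq> Pow E"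
    and eq: "\<And>B. B \<subseteq> E \<Longrightarrow> measure_pmf.prob P (Pow B) = measure_pmf.prob Q (Pow B)"
  shows "P = Q"
proof (rule pmf_eqI)
  fix B
  show "pmf P B = pmf Q B"
  proof (cases "B \<subseteq> E")
    case True
    then have "finite B"
      using E by (rule finite_subset)
    then show ?thesis
      using True
    proof (induction rule: finite_psubset_induct)
      case (psubset B)
      have "measure_pmf.prob M (Pow B) = pmf M B + (\<Sum>C\<in>Pow B - {B}. pmf M C)" for M
        using psubset.hyps by (subst measure_measure_pmf_finite) (auto simp: sum.remove)
      moreover have "(\<Sum>C\<in>Pow B - {B}. pmf P C) = (\<Sum>C\<in>Pow B - {B}. pmf Q C)"
        using psubset by (intro sum.cong) auto
      ultimately show ?case
        using eq[OF psubset.prems] by simp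
    qed
  next
    case False
    then have "B \<notin> set_pmf P" "B \<notin> set_pmf Q"
      using sub by auto
    then show ?thesis
      by (simp add: set_pmf_iff)
  qed
qed

lemma prob_random_edges_Pow:
  assumes V: "finite V" "2 \<le> card V" and B: "B \<subseteq> all_edges V"
  shows "measure_pmf.prob (random_edges V k) (Pow B) =
         (real (card B) / real (card V choose 2)) ^ k"
proof (induction k)
  case (Suc k)
  let ?z = "real (card B) / real (card V choose 2)"
  have "measure_pmf.prob (map_pmf (insert e) (random_edges V k)) (Pow B) =
      (if e \<in> B then ?z ^ k else 0)" for e
  proof -
    have "insert e -` Pow B = (if e \<in> B then Pow B else {})"
      by auto
    then show ?thesis
      by (simp add: Suc.IH)
  qed
  then have "measure_pmf.prob (random_edges V (Suc k)) (Pow B) =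
      (\<Sum>e\<in>all_edges V. if e \<in> B then ?z ^ k else 0) / real (card (all_edges V))"
    using V all_edges_nonempty[OF V] by (simp add: prob_bind_pmf integral_pmf_of_set del: measure_map_pmf)
  also have "(\<Sum>e\<in>all_edges V. if e \<in> B then ?z ^ k else 0) = real (card B) * ?z ^ k"
    using V B by (simp add: sum.If_cases Int_absorb1)
  finally show ?case
    using V by (simp add: card_all_edges)
qed (simp add: Pow_def)

text \<open>The probability generating function; \<open>z\<close> will be the chance that one
  uniform edge falls into a given edge set.\<close>

lemma expectation_poisson_power:
  assumes "0 < rate" "0 \<le> z" "z \<le> 1"
  shows "measure_pmf.expectation (poisson_pmf rate) (\<lambda>k. z ^ k) = exp (- rate * (1 - z))"
proof -
  have int: "integrable (poisson_pmf rate) (\<lambda>k. z ^ k)"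
    using assms by (intro measure_pmf.integrable_const_bound[where B = 1]) (auto simp: power_le_one)
  have "(\<lambda>k. (rate * z) ^ k / fact k * exp (- rate)) sums (exp (rate * z) * exp (- rate))"
    using exp_converges[of "rate * z"] by (intro sums_mult2) (simp add: field_simps)
  then have sums: "(\<lambda>k. rate ^ k / fact k * exp (- rate) * z ^ k) sums exp (- rate * (1 - z))"
    by (simp add: power_mult_distrib exp_add[symmetric] algebra_simps)
  have "ennreal (measure_pmf.expectation (poisson_pmf rate) (\<lambda>k. z ^ k)) =
      (\<integral>\<^sup>+k. ennreal (z ^ k) \<partial>poisson_pmf rate)"
    using assms int by (intro nn_integral_eq_integral[symmetric]) auto
  also have "\<dots> = (\<Sum>k. ennreal (rate ^ k / fact k * exp (- rate) * z ^ k))"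
    using assms by (simp add: nn_integral_measure_pmf nn_integral_count_space_nat ennreal_mult[symmetric])
  also have "\<dots> = ennreal (exp (- rate * (1 - z)))"
    using assms sums by (intro suminf_ennreal_eq) auto
  finally show ?thesis
    using assms by (simp add: integral_nonneg_AE)
qed

section \<open>Avoidance probabilities, unions and monotonicity of binomial random graphs\<close>

lemma set_pmf_binomial_graph: "set_pmf (binomial_graph V q) \<subseteq> Pow (all_edges V)"
  by (auto simp: binomial_graph_def)

lemma prob_binomial_graph_Pow:
  assumes V: "finite V" and q: "q \<in> {0..1}" and B: "B \<subseteq> all_edges V"
  shows "measure_pmf.prob (binomial_graph V q) (Pow B) = (1 - q) ^ ((card V choose 2) - card B)"
proof -
  let ?E = "all_edges V"
  have "(\<lambda>b. {e \<in> ?E. b e}) -` Pow B = Pi ?E (\<lambda>e. if e \<in> B then UNIV else {False})"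
    by (auto simp: Pi_def)
  then have "measure_pmf.prob (binomial_graph V q) (Pow B) =
      (\<Prod>e\<in>?E. measure_pmf.prob (bernoulli_pmf q) (if e \<in> B then UNIV else {False}))"
    using V by (simp add: binomial_graph_def measure_Pi_pmf_Pi)
  also have "\<dots> = (\<Prod>e\<in>?E. if e \<in> B then 1 else 1 - q)"
    using q by (intro prod.cong) (auto simp: measure_pmf_single)
  also have "\<dots> = (1 - q) ^ card (?E - B)"
    using V by (simp add: prod.If_cases Diff_eq[symmetric])
  also have "card (?E - B) = (card V choose 2) - card B"
    using V B by (simp add: card_Diff_subset finite_subset[OF B] card_all_edges)
  finally show ?thesis .
qed

text \<open>Poisson thinning: in a Poisson number of uniform edges the multiplicities are independent.\<close>
lemma poisson_random_edges:
  assumes V: "finite V" "2 \<le> card V" and l: "0 < rate"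
  shows "bind_pmf (poisson_pmf rate) (random_edges V) =
         binomial_graph V (1 - exp (- rate / real (card V choose 2)))"
proof (rule pmf_eq_if_prob_Pow_eq)
  let ?N = "card V choose 2"
  have N: "0 < ?N"
    using V by (simp add: zero_less_binomial_iff)
  show "finite (all_edges V)"
    using V by simp
  show "set_pmf (bind_pmf (poisson_pmf rate) (random_edges V)) \<subseteq> Pow (all_edges V)"
    using set_pmf_random_edges(1)[OF V] by auto
  show "set_pmf (binomial_graph V (1 - exp (- rate / real ?N))) \<subseteq> Pow (all_edges V)"
    by (rule set_pmf_binomial_graph)
  fix B assume B: "B \<subseteq> all_edges V"
  then have "card B \<le> ?N"
    using V card_mono[of "all_edges V" B] by (simp add: card_all_edges)
  then have "measure_pmf.prob (bind_pmf (poisson_pmf rate) (random_edges V)) (Pow B) =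
      exp (- rate * (1 - real (card B) / real ?N))"
    using l N by (simp add: prob_bind_pmf prob_random_edges_Pow[OF V B] expectation_poisson_power)
  \<comment> \<open>Each edge outside \<open>B\<close> contributes the factor
    \<open>exp (- rate / real ?N)\<close>, the probability that it is never drawn.\<close>
  also have "\<dots> = exp (real (?N - card B) * (- rate / real ?N))"
    using N \<open>card B \<le> ?N\<close> by (simp add: field_simps of_nat_diff)
  also have "\<dots> = exp (- rate / real ?N) ^ (?N - card B)"
    by (rule exp_of_nat_mult)
  finally show "measure_pmf.prob (bind_pmf (poisson_pmf rate) (random_edges V)) (Pow B) =
      measure_pmf.prob (binomial_graph V (1 - exp (- rate / real ?N))) (Pow B)"
    using l V B by (subst prob_binomial_graph_Pow) auto
qed

text \<open>An edge is absent from the union iff it is absent from both independent graphs, so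
  avoidance probabilities multiply.\<close>

lemma binomial_graph_union:
  assumes V: "finite V" and q: "q \<in> {0..1}" "r \<in> {0..1}"
  shows "binomial_graph V (1 - (1 - q) * (1 - r)) =
         bind_pmf (binomial_graph V q) (\<lambda>S. map_pmf ((\<union>) S) (binomial_graph V r))"
    (is "_ = ?Q")
proof (rule pmf_eq_if_prob_Pow_eq)
  have 01: "1 - (1 - q) * (1 - r) \<in> {0..1}"
    using q by (auto simp: mult_le_one)
  show "finite (all_edges V)"
    using V by simp
  show "set_pmf (binomial_graph V (1 - (1 - q) * (1 - r))) \<subseteq> Pow (all_edges V)"
    by (rule set_pmf_binomial_graph)
  show "set_pmf ?Q \<subseteq> Pow (all_edges V)"
    using set_pmf_binomial_graph by fastforce
  fix B assume B: "B \<subseteq> all_edges V"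
  have "(\<union>) S -` Pow B = (if S \<in> Pow B then Pow B else {})" for S
    by auto
  then have "measure_pmf.prob (map_pmf ((\<union>) S) (binomial_graph V r)) (Pow B) =
      indicator (Pow B) S * measure_pmf.prob (binomial_graph V r) (Pow B)" for S
    by (simp add: indicator_def)
  then have "measure_pmf.prob ?Q (Pow B) =
      measure_pmf.prob (binomial_graph V q) (Pow B) * measure_pmf.prob (binomial_graph V r) (Pow B)"
    by (simp add: prob_bind_pmf del: measure_map_pmf)
  then show "measure_pmf.prob (binomial_graph V (1 - (1 - q) * (1 - r))) (Pow B) =
      measure_pmf.prob ?Q (Pow B)"
    using V q 01 B by (simp add: prob_binomial_graph_Pow power_mult_distrib)
qed

lemma rel_pmf_binomial_graph_mono:
  assumes V: "finite V" and q: "0 \<le> q" "q \<le> q'" "q' \<le> 1"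
  shows "rel_pmf (\<subseteq>) (binomial_graph V q) (binomial_graph V q')"
proof (cases "q = 1")
  case False
  \<comment> \<open>Sprinkling: \<open>r\<close> solves \<open>1 - q' = (1 - q) * (1 - r)\<close>.
    The case \<open>q = 1\<close>, where also \<open>q' = 1\<close>, is set apart to avoid division
    by 0.\<close>
  define r where "r = 1 - (1 - q') / (1 - q)"
  have r: "r \<in> {0..1}" "q' = 1 - (1 - q) * (1 - r)"
    using q False by (auto simp: r_def field_simps)
  have "rel_pmf (\<subseteq>) (bind_pmf (binomial_graph V q) return_pmf)
          (bind_pmf (binomial_graph V q) (\<lambda>S. map_pmf ((\<union>) S) (binomial_graph V r)))"
    by (rule rel_pmf_bindI[where R = "(=)"]) (auto simp: pmf.rel_eq rel_pmf_return_pmf1)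
  then show ?thesis
    using q r V by (simp add: binomial_graph_union bind_return_pmf')
qed (use q in \<open>auto intro: rel_pmf_reflI\<close>)

text \<open>Quantifying over all sets, not only over graphs on \<open>V\<close>, lets a coupling by
  inclusion be used without tracking supports.\<close>

definition up_closed :: "'a set set \<Rightarrow> bool" where
  "up_closed U \<longleftrightarrow> (\<forall>S T. S \<in> U \<longrightarrow> S \<subseteq> T \<longrightarrow> T \<in> U)"

lemma prob_mono_up_closed:
  assumes "rel_pmf (\<subseteq>) P Q" "up_closed U"
  shows "measure_pmf.prob P U \<le> measure_pmf.prob Q U"
proof -
  have "measure_pmf.prob P U \<le> measure_pmf.prob Q {T. \<exists>S\<in>U. S \<subseteq> T}"
    using assms(1) by (rule rel_pmf_measureD)
  also have "{T. \<exists>S\<in>U. S \<subseteq> T} = U"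
    using assms(2) by (auto simp: up_closed_def)
  finally show ?thesis .
qed

subsection \<open>Binomial and Poisson weights\<close>

text \<open>Stirling's formula with explicit constants. The difference equals 1 at 1 and decreases,
  since \<open>ln (1 + 1/m)\<close> lies between the midpoint and the trapezoid estimates of the
  integral of \<open>1/x\<close>; each decrement is at most a quarter of
  \<open>1/m - 1/(m+1)\<close>.\<close>

lemma ln_fact_bounds:
  assumes "1 \<le> m"
  shows "ln (fact m) + real m - (real m + 1/2) * ln (real m) \<in> {0..1}"
proof -
  define s where "s m = ln (fact m) + real m - (real m + 1/2) * ln (real m)" for m
  define c where "c m = 1 / real m" for m :: nat
  have step_bounds: "s m - (c m - c (Suc m)) / 4 \<le> s (Suc m) \<and> s (Suc m) \<le> s m"
    if "1 \<le> m" for m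
  proof -
    define d where "d = ln (real m + 1) - ln (real m)"
    have m: "real m > 0"
      using that by simp
    have "ln (fact (Suc m)) = ln (real m + 1) + ln (fact m)"
      using ln_mult[of "real m + 1" "fact m"] by (simp add: add.commute)
    then have s: "s (Suc m) = s m + 1 - (real m + 1/2) * d"
      by (simp add: s_def d_def algebra_simps)
    have "2 / (2 * real m + 1) \<le> d" "d \<le> (inverse (real m) + inverse (real m + 1)) / 2"
      using ln_inverse_approx_ge[of "real m" "real m + 1"] ln_inverse_approx_le[of "real m" 1] m
      by (simp_all add: d_def)
    then have "(real m + 1/2) * (2 / (2 * real m + 1)) \<le> (real m + 1/2) * d"
      "(real m + 1/2) * d \<le> (real m + 1/2) * ((inverse (real m) + inverse (real m + 1)) / 2)"
      by (intro mult_left_mono; simp)+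
    moreover have "(real m + 1/2) * (2 / (2 * real m + 1)) = 1"
      using m by (simp add: field_simps)
    moreover have "(real m + 1/2) * ((inverse (real m) + inverse (real m + 1)) / 2) =
        1 + (c m - c (Suc m)) / 4"
      using m by (simp add: c_def divide_simps) (simp add: algebra_simps)
    ultimately show ?thesis
      using s by linarith
  qed
  \<comment> \<open>The decrements telescope: up to \<open>m\<close> they sum to at most
    \<open>(1 - c m) / 4\<close>.\<close>
  have "3/4 + c m / 4 \<le> s m \<and> s m \<le> 1"
    using assms
  proof (induction m rule: dec_induct)
    case base
    then show ?case by (simp add: s_def c_def)
  next
    case (step k)
    then show ?case
      using step_bounds[of k] by (auto simp: field_simps)
  qed
  moreover have "0 \<le> c m"
    by (simp add: c_def)
  ultimately show ?thesis
    unfolding s_def by simp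
qed

lemma fact_bounds:
  assumes "1 \<le> m"
  shows "sqrt (real m) * (real m ^ m * exp (- real m)) \<le> fact m"
    and "fact m \<le> exp 1 * (sqrt (real m) * (real m ^ m * exp (- real m)))"
proof -
  let ?L = "(real m + 1/2) * ln (real m) - real m"
  have m: "0 < real m"
    using assms by simp
  have "exp ?L = exp (ln (real m) / 2) * (exp (real m * ln (real m)) * exp (- real m))"
    by (simp add: exp_add[symmetric] algebra_simps)
  also have "exp (ln (real m) / 2) = sqrt (real m)"
    using m by (simp add: ln_sqrt[symmetric])
  also have "exp (real m * ln (real m)) = real m ^ m"
    using m by (simp add: exp_of_nat_mult)
  finally have L: "exp ?L = sqrt (real m) * (real m ^ m * exp (- real m))" .
  have "?L \<le> ln (fact m)" "ln (fact m) \<le> 1 + ?L"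
    using ln_fact_bounds[OF assms] unfolding atLeastAtMost_iff by linarith+
  then have "exp ?L \<le> exp (ln (fact m))" "exp (ln (fact m)) \<le> exp 1 * exp ?L"
    unfolding exp_add[symmetric] exp_le_cancel_iff .
  then show "sqrt (real m) * (real m ^ m * exp (- real m)) \<le> fact m"
    "fact m \<le> exp 1 * (sqrt (real m) * (real m ^ m * exp (- real m)))"
    unfolding L by simp_all
qed

text \<open>For fixed \<open>j\<close> the weight is largest at \<open>\<mu> = j\<close>, where
  Stirling's lower bound applies.\<close>

lemma poisson_weight_le_inverse_sqrt:
  assumes "0 < (\<mu>::real)"
  shows "sqrt (real j) * (\<mu> ^ j * exp (- \<mu>) / fact j) \<le> 1"
proof (cases "j = 0")
  case False
  then have j: "0 < real j" "1 \<le> j"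
    by auto
  \<comment> \<open>This inequality expresses the maximality at \<open>\<mu> = j\<close>.\<close>
  have "ln (\<mu> / real j) \<le> \<mu> / real j - 1"
    using j assms by (intro ln_le_minus_one) auto
  then have "real j * ln \<mu> - \<mu> \<le> real j * ln (real j) - real j"
    using j assms by (simp add: ln_div field_simps)
  then have "exp (real j * ln \<mu> - \<mu>) \<le> exp (real j * ln (real j) - real j)"
    by simp
  then have "\<mu> ^ j * exp (- \<mu>) \<le> real j ^ j * exp (- real j)"
    using j assms by (simp add: exp_diff exp_of_nat_mult exp_minus divide_inverse)
  then have "sqrt (real j) * (\<mu> ^ j * exp (- \<mu>)) \<le> fact j"
    using fact_bounds(1)[OF j(2)] mult_left_mono[of _ _ "sqrt (real j)"] by (meson order_trans real_sqrt_ge_zero of_nat_0_le_iff)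
  then show ?thesis
    by simp
qed simp

text \<open>To replace \<open>sqrt j\<close> by \<open>sqrt \<mu>\<close>,
  \<open>2 * sqrt \<mu>\<close> is bounded by \<open>\<mu> / r + r\<close> with
  \<open>r = sqrt (j + 1)\<close>. The first term shifts the weight from \<open>j\<close> to
  \<open>j + 1\<close>, and the previous bound applies to both terms.\<close>

lemma poisson_weight_le:
  assumes "0 < (\<mu>::real)"
  shows "sqrt \<mu> * (\<mu> ^ j * exp (- \<mu>) / fact j) \<le> 3/2"
proof -
  let ?t = "\<lambda>j. \<mu> ^ j * exp (- \<mu>) / fact j" and ?r = "sqrt (real (Suc j))"
  have t: "0 \<le> ?t j"
    using assms by simp
  have r: "0 < ?r"
    by simp
  have "2 * sqrt \<mu> \<le> \<mu> / ?r + ?r"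
  proof -
    have "0 \<le> (sqrt \<mu> - ?r)\<^sup>2"
      by simp
    then have "2 * sqrt \<mu> * ?r \<le> \<mu> + ?r * ?r"
      using assms by (simp add: power2_diff)
    then show ?thesis
      using r by (simp add: field_simps)
  qed
  then have "2 * sqrt \<mu> * ?t j \<le> (\<mu> / ?r + ?r) * ?t j"
    using t by (rule mult_right_mono)
  also have "\<dots> = \<mu> / ?r * ?t j + ?r * ?t j"
    by (rule distrib_right)
  also have "\<mu> / ?r * ?t j = ?r * ?t (Suc j)"
  proof -
    have div: "a / r * x = r * z" if "a * x = r * r * z" "0 < r" for a r x z :: real
      using that by (simp add: field_simps)
    have "\<mu> * ?t j = real (Suc j) * ?t (Suc j)"
      by (simp add: field_simps del: of_nat_Suc)
    also have "real (Suc j) = ?r * ?r"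
      by simp
    finally show ?thesis
      using r by (rule div)
  qed
  also have "?r * ?t (Suc j) \<le> 1"
    using poisson_weight_le_inverse_sqrt[OF assms] .
  also have "?r * ?t j \<le> 2"
  proof (cases "j = 0")
    case True
    then have "?r * ?t j = exp (- \<mu>)"
      by simp
    moreover have "exp (- \<mu>) \<le> 1"
      using assms by simp
    ultimately show ?thesis
      by linarith
  next
    case False
    have "?r \<le> sqrt (4 * real j)"
      using False by (intro real_sqrt_le_mono) simp
    then have "?r * ?t j \<le> 2 * sqrt (real j) * ?t j"
      using t by (intro mult_right_mono) (auto simp: real_sqrt_mult)
    also have "\<dots> \<le> 2"
      using poisson_weight_le_inverse_sqrt[OF assms, of j] unfolding mult.assoc by linarith
    finally show ?thesis .
  qed
  finally show ?thesis
    unfolding mult.assoc by linarith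
qed

text \<open>A binomial variable is one of two independent Poisson variables with means
  \<open>m * q\<close> and \<open>m * (1 - q)\<close>, conditioned on their sum being
  \<open>m\<close>. The ratio of the weights is therefore the weight of the second variable at
  \<open>m - k\<close> divided by that of a Poisson variable of mean \<open>m\<close> at
  \<open>m\<close>. Both have order at most resp. exactly \<open>1 / sqrt m\<close>, since
  \<open>q \<le> 1/2\<close>.\<close>

lemma pmf_binomial_le_poisson:
  assumes q: "0 < q" "q \<le> 1/2" and m: "1 \<le> m"
  shows "pmf (binomial_pmf m q) k \<le> 8 * pmf (poisson_pmf (real m * q)) k"
proof (cases "k \<le> m")
  case True
  define j where "j = m - k"
  define \<mu> where "\<mu> = real m * (1 - q)"
  define C where "C = real m ^ m * exp (- real m)"
  have mk: "m = k + j" "m - k = j"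
    using True by (auto simp: j_def)
  have pos: "0 < real m" "0 < \<mu>" "0 < real m * q" "0 < C"
    using q m by (auto simp: \<mu>_def C_def)
  have ratio: "sqrt (real m) \<le> 3/2 * sqrt \<mu>"
  proof -
    have "sqrt (real m) \<le> sqrt ((3/2)\<^sup>2 * \<mu>)"
      using q pos by (intro real_sqrt_le_mono) (simp add: \<mu>_def field_simps power2_eq_square)
    then show ?thesis
      by (simp add: real_sqrt_mult)
  qed
  have "fact m * (\<mu> ^ j * exp (- \<mu>) / fact j) \<le>
      exp 1 * (sqrt (real m) * C) * (\<mu> ^ j * exp (- \<mu>) / fact j)"
    using fact_bounds(2)[OF m] pos by (intro mult_right_mono) (auto simp: C_def)
  also have "\<dots> \<le> exp 1 * ((3/2 * sqrt \<mu>) * C) * (\<mu> ^ j * exp (- \<mu>) / fact j)"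
    using ratio pos by (intro mult_right_mono mult_left_mono) auto
  also have "\<dots> = exp 1 * (3/2) * C * (sqrt \<mu> * (\<mu> ^ j * exp (- \<mu>) / fact j))"
    by simp
  also have "\<dots> \<le> exp 1 * (3/2) * C * (3/2)"
    using poisson_weight_le[OF pos(2)] pos by (intro mult_left_mono) auto
  \<comment> \<open>From \<open>exp 1 \<le> 3\<close> the constant is at most
    \<open>27/4\<close>.\<close>
  also have "\<dots> \<le> 8 * C"
    using exp_le pos by (simp add: mult_right_mono[where c = C])
  finally have *: "fact m * (\<mu> ^ j * exp (- \<mu>) / fact j) \<le> 8 * C" .
  \<comment> \<open>Multiplication by \<open>D\<close> clears denominators: the two weights become
    \<open>q ^ k\<close> times the two sides of the bound just proved.\<close>
  define D where "D = real m ^ j * exp (- \<mu>) * fact k"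
  have D: "0 < D"
    using pos by (simp add: D_def)
  have "pmf (binomial_pmf m q) k * D =
      (fact m / (fact k * fact j) * q ^ k * (1 - q) ^ j) * (real m ^ j * exp (- \<mu>) * fact k)"
    using q True binomial_fact[of k m, where 'a = real] by (simp add: mk(2) D_def)
  also have "\<dots> = q ^ k * (fact m * (\<mu> ^ j * exp (- \<mu>) / fact j))"
    by (simp add: \<mu>_def power_mult_distrib)
  also have "\<dots> \<le> q ^ k * (8 * C)"
    using * q by (intro mult_left_mono) auto
  also have "\<dots> = 8 * ((real m * q) ^ k / fact k * exp (- (real m * q))) * D"
  proof -
    have "exp (- (real m * q)) * exp (- \<mu>) = exp (- real m)"
      by (simp add: \<mu>_def exp_add[symmetric] algebra_simps)
    moreover have "real m ^ m = real m ^ k * real m ^ j"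
      by (simp only: mk(1) power_add)
    ultimately have C: "C = real m ^ k * real m ^ j * (exp (- (real m * q)) * exp (- \<mu>))"
      by (simp add: C_def)
    show ?thesis
      by (simp add: C D_def power_mult_distrib)
  qed
  also have "\<dots> = 8 * pmf (poisson_pmf (real m * q)) k * D"
    using pos by simp
  finally show ?thesis
    using D by simp
qed (use q m in \<open>simp add: binomial_eq_0\<close>)

subsection \<open>Tail bounds and transfer\<close>

lemma prob_le_prob_if_pmf_le:
  assumes "\<And>x. x \<in> X \<Longrightarrow> pmf P x \<le> c * pmf Q x" "0 \<le> c"
  shows "measure_pmf.prob P X \<le> c * measure_pmf.prob Q X"
proof -
  have "emeasure P X = (\<integral>\<^sup>+x. pmf P x \<partial>count_space X)"
    by (rule nn_integral_pmf[symmetric])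
  also have "\<dots> \<le> (\<integral>\<^sup>+x. ennreal c * pmf Q x \<partial>count_space X)"
    using assms by (intro nn_integral_mono) (auto simp: ennreal_mult[symmetric] intro: ennreal_leI)
  also have "\<dots> = ennreal c * emeasure Q X"
    by (simp add: nn_integral_cmult nn_integral_pmf)
  finally show ?thesis
    using assms(2) by (simp add: measure_pmf.emeasure_eq_measure ennreal_mult[symmetric])
qed

text \<open>A constant factor between mixing weights passes to every event; it will be applied to
  failure events, which tolerate it.\<close>

lemma prob_bind_pmf_le_if_pmf_le:
  assumes "\<And>x. pmf P x \<le> c * pmf Q x" "0 \<le> c"
  shows "measure_pmf.prob (bind_pmf P f) X \<le> c * measure_pmf.prob (bind_pmf Q f) X"
proof -
  have "emeasure (bind_pmf P f) X = (\<integral>\<^sup>+x. ennreal (pmf P x) * emeasure (f x) X \<partial>count_space UNIV)"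
    by (simp add: nn_integral_measure_pmf)
  also have "\<dots> \<le> (\<integral>\<^sup>+x. ennreal c * (ennreal (pmf Q x) * emeasure (f x) X) \<partial>count_space UNIV)"
    using assms by (intro nn_integral_mono)
      (auto simp: mult.assoc[symmetric] ennreal_mult[symmetric] intro!: mult_right_mono ennreal_leI)
  also have "\<dots> = ennreal c * emeasure (bind_pmf Q f) X"
    by (simp add: nn_integral_cmult nn_integral_measure_pmf)
  finally show ?thesis
    using assms(2) by (simp add: measure_pmf.emeasure_eq_measure ennreal_mult[symmetric] del: emeasure_bind_pmf)
qed

text \<open>Independence makes exponential moments multiplicative. Nonnegative integrals spare
  integrability conditions.\<close>

lemma nn_integral_exp_iid_sum:
  "(\<integral>\<^sup>+k. ennreal (exp (- t * real k)) \<partial>iid_sum K m) =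
   (\<integral>\<^sup>+k. ennreal (exp (- t * real k)) \<partial>K) ^ m"
proof (induction m)
  case (Suc m)
  let ?e = "\<lambda>k. ennreal (exp (- t * real k))"
  have "?e (x + y) = ?e x * ?e y" for x y
    by (simp add: ennreal_mult[symmetric] exp_add[symmetric] algebra_simps)
  then have "(\<integral>\<^sup>+k. ?e k \<partial>iid_sum K (Suc m)) = (\<integral>\<^sup>+x. ?e x * (\<integral>\<^sup>+y. ?e y \<partial>iid_sum K m) \<partial>K)"
    by (simp only: iid_sum.simps nn_integral_bind_pmf nn_integral_map_pmf) (simp add: nn_integral_cmult)
  also have "\<dots> = (\<integral>\<^sup>+x. ?e x \<partial>K) * (\<integral>\<^sup>+y. ?e y \<partial>iid_sum K m)"
    by (rule nn_integral_multc) simp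
  finally show ?case
    unfolding Suc.IH power_Suc .
qed simp

lemma binomial_pmf_eq_iid_sum:
  assumes "p \<in> {0..1}"
  shows "binomial_pmf n p = iid_sum (map_pmf of_bool (bernoulli_pmf p)) n"
proof (induction n)
  case (Suc n)
  have "(if b then 1 else 0) = (of_bool b :: nat)" for b
    by simp
  then show ?case
    using assms by (simp only: binomial_pmf_Suc iid_sum.simps Suc.IH bind_map_pmf map_pmf_def[of "(+) _"])
qed (use binomial_pmf_0[OF assms] in simp)

text \<open>The product of \<open>1 - s + s^2/2\<close> and \<open>1 + s + s^2/2\<close> is
  \<open>1 + s^4/4\<close>, and the second factor is at most \<open>exp s\<close>. Besides the
  moment bounds this yields the quadratic corrections in the edge probabilities, through
  \<open>1 - exp (- x) \<ge> x - x^2/2\<close>.\<close>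

lemma exp_minus_le_quadratic:
  assumes "0 \<le> (s::real)"
  shows "exp (- s) \<le> 1 - s + s\<^sup>2 / 2"
proof -
  have "0 < 1 + s + s\<^sup>2 / 2"
    using assms by (simp add: add_pos_nonneg)
  have "1 \<le> 1 + (s\<^sup>2)\<^sup>2 / 4"
    by simp
  also have "\<dots> = (1 - s + s\<^sup>2 / 2) * (1 + s + s\<^sup>2 / 2)"
    by (simp add: algebra_simps power2_eq_square)
  finally have "1 / (1 + s + s\<^sup>2 / 2) \<le> 1 - s + s\<^sup>2 / 2"
    using \<open>0 < 1 + s + s\<^sup>2 / 2\<close> by (simp add: field_simps)
  moreover have "exp (- s) \<le> 1 / (1 + s + s\<^sup>2 / 2)"
    using exp_lower_Taylor_quadratic[OF assms] \<open>0 < 1 + s + s\<^sup>2 / 2\<close>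
    by (simp add: exp_minus field_simps)
  ultimately show ?thesis
    by linarith
qed

lemma nn_integral_exp_binomial_le:
  assumes p: "p \<in> {0..1}" and s: "0 \<le> s"
  shows "(\<integral>\<^sup>+k. ennreal (exp (- s * real k)) \<partial>binomial_pmf n p) \<le>
         ennreal (exp (- real n * p * (s - s\<^sup>2 / 2)))"
proof -
  have "(\<integral>\<^sup>+k. ennreal (exp (- s * real k)) \<partial>map_pmf of_bool (bernoulli_pmf p)) =
      ennreal (exp (- s)) * ennreal p + ennreal (1 - p)"
    using p by simp
  also have "\<dots> = ennreal (1 + p * (exp (- s) - 1))"
    using p by (simp add: ennreal_mult[symmetric] ennreal_plus[symmetric] algebra_simps del: ennreal_plus)
  also have "\<dots> \<le> ennreal (exp (- p * (s - s\<^sup>2 / 2)))"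
  proof (rule ennreal_leI)
    have "p * (exp (- s) - 1) \<le> p * (- s + s\<^sup>2 / 2)"
      using exp_minus_le_quadratic[OF s] p by (intro mult_left_mono) auto
    then have "1 + p * (exp (- s) - 1) \<le> 1 + - p * (s - s\<^sup>2 / 2)"
      by (simp add: algebra_simps)
    also have "\<dots> \<le> exp (- p * (s - s\<^sup>2 / 2))"
      by (rule exp_ge_add_one_self)
    finally show "1 + p * (exp (- s) - 1) \<le> exp (- p * (s - s\<^sup>2 / 2))" .
  qed
  finally have "(\<integral>\<^sup>+k. ennreal (exp (- s * real k)) \<partial>binomial_pmf n p) \<le>
      ennreal (exp (- p * (s - s\<^sup>2 / 2))) ^ n"
    unfolding binomial_pmf_eq_iid_sum[OF p] nn_integral_exp_iid_sum by (rule power_mono) simp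
  also have "\<dots> = ennreal (exp (- real n * p * (s - s\<^sup>2 / 2)))"
    by (simp add: ennreal_power exp_of_nat_mult[symmetric] mult_ac)
  finally show ?thesis .
qed

text \<open>Chernoff's bound with parameter \<open>2 * s\<close>. As
  \<open>2 * (x div 2) \<ge> x - 1\<close>, halving costs a factor \<open>exp s\<close> per feature,
  which accounts for the summand \<open>real m * s\<close>.\<close>

lemma prob_iid_sum_half_binomial_le:
  assumes p: "p \<in> {0..1}" and s: "0 \<le> s"
  shows "measure_pmf.prob (iid_sum (map_pmf (\<lambda>x. x div 2) (binomial_pmf n p)) m) {k. real k \<le> y} \<le>
         exp (2 * s * y + real m * (s - real n * p * (s - s\<^sup>2 / 2)))" (is "measure_pmf.prob ?K ?X \<le> _")
proof -
  have half: "exp (- (2 * s) * real (x div 2)) \<le> exp s * exp (- s * real x)" for x :: nat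
  proof -
    have "real x \<le> 2 * real (x div 2) + 1"
      by linarith
    then have "s * real x \<le> s * (2 * real (x div 2) + 1)"
      using s by (rule mult_left_mono)
    then show ?thesis
      by (simp add: exp_add[symmetric] algebra_simps)
  qed
  have "emeasure ?K ?X = (\<integral>\<^sup>+k. indicator ?X k \<partial>?K)"
    by simp
  also have "\<dots> \<le> (\<integral>\<^sup>+k. ennreal (exp (2 * s * y)) * ennreal (exp (- (2 * s) * real k)) \<partial>?K)"
  proof (rule nn_integral_mono)
    fix k
    have "1 \<le> exp (2 * s * y) * exp (- (2 * s) * real k)" if "real k \<le> y"
      using mult_left_mono[OF that s] by (simp add: exp_add[symmetric] mult.assoc)
    then show "indicator ?X k \<le> ennreal (exp (2 * s * y)) * ennreal (exp (- (2 * s) * real k))"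
      by (auto simp: indicator_def ennreal_mult[symmetric] simp del: ennreal_1 simp flip: ennreal_1
          intro!: ennreal_leI)
  qed
  also have "\<dots> = ennreal (exp (2 * s * y)) *
      (\<integral>\<^sup>+x. ennreal (exp (- (2 * s) * real (x div 2))) \<partial>binomial_pmf n p) ^ m"
    by (subst nn_integral_cmult) (simp_all only: nn_integral_exp_iid_sum nn_integral_map_pmf, simp)
  also have "(\<integral>\<^sup>+x. ennreal (exp (- (2 * s) * real (x div 2))) \<partial>binomial_pmf n p) \<le>
      (\<integral>\<^sup>+x. ennreal (exp s) * ennreal (exp (- s * real x)) \<partial>binomial_pmf n p)"
    using half by (intro nn_integral_mono) (auto simp: ennreal_mult[symmetric] intro!: ennreal_leI)
  also have "\<dots> = ennreal (exp s) * (\<integral>\<^sup>+x. ennreal (exp (- s * real x)) \<partial>binomial_pmf n p)"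
    by (simp add: nn_integral_cmult)
  also have "\<dots> \<le> ennreal (exp s) * ennreal (exp (- real n * p * (s - s\<^sup>2 / 2)))"
    using nn_integral_exp_binomial_le[OF p s] by (rule mult_left_mono) simp
  also have "\<dots> = ennreal (exp (s - real n * p * (s - s\<^sup>2 / 2)))"
    by (simp add: ennreal_mult[symmetric] exp_add[symmetric])
  finally have "emeasure ?K ?X \<le>
      ennreal (exp (2 * s * y)) * ennreal (exp (s - real n * p * (s - s\<^sup>2 / 2))) ^ m"
    by (simp add: mult_left_mono power_mono)
  also have "\<dots> = ennreal (exp (2 * s * y + real m * (s - real n * p * (s - s\<^sup>2 / 2))))"
    by (simp add: ennreal_power ennreal_mult[symmetric] exp_add exp_of_nat_mult)
  finally show ?thesis
    by (simp add: measure_pmf.emeasure_eq_measure)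
qed

text \<open>Exponential tilting: beyond \<open>y\<close> the weights are at most \<open>c\<close>
  times those of the Poisson law with mean \<open>rate * exp t\<close>. For
  \<open>t \<le> 1\<close>, \<open>exp t - 1 \<le> t + t^2\<close>.\<close>

lemma prob_poisson_gt_le:
  assumes "0 < rate" "0 \<le> t" "t \<le> 1"
  shows "measure_pmf.prob (poisson_pmf rate) {k. y < real k} \<le> exp (rate * (t + t\<^sup>2) - t * y)"
    (is "?P \<le> _")
proof -
  define c where "c = exp (rate * (exp t - 1) - t * y)"
  have pos: "0 < rate * exp t"
    using assms by simp
  have "?P \<le> c * measure_pmf.prob (poisson_pmf (rate * exp t)) {k. y < real k}"
  proof (rule prob_le_prob_if_pmf_le)
    fix k assume "k \<in> {k. y < real k}"
    then have "t * y \<le> t * real k"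
      using assms by (intro mult_left_mono) auto
    then have "exp (- rate) \<le> exp (t * real k - t * y - rate)"
      by simp
    also have "\<dots> = c * (exp t ^ k * exp (- (rate * exp t)))"
      by (simp add: c_def exp_of_nat_mult[symmetric] exp_add[symmetric] algebra_simps)
    finally have "rate ^ k / fact k * exp (- rate) \<le>
        rate ^ k / fact k * (c * (exp t ^ k * exp (- (rate * exp t))))"
      using assms by (intro mult_left_mono) auto
    then show "pmf (poisson_pmf rate) k \<le> c * pmf (poisson_pmf (rate * exp t)) k"
      using assms pos by (simp add: power_mult_distrib mult_ac)
  qed (simp add: c_def)
  also have "\<dots> \<le> c * 1"
    by (intro mult_left_mono) (auto simp: c_def)
  also have "\<dots> \<le> exp (rate * (t + t\<^sup>2) - t * y)"
    using exp_bound[of t] assms by (simp add: c_def)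
  finally show ?thesis .
qed

text \<open>Only a constant fraction of the Poisson mass has to lie below \<open>y\<close>: this already bounds the
  failure probability at \<open>y\<close> edges by a constant multiple of the Poisson average.\<close>
lemma failure_prob_le_poisson_random_edges:
  assumes V: "finite V" "2 \<le> card V" and U: "up_closed U" and rate: "0 < rate"
    and rel: "rel_pmf (\<subseteq>) (bind_pmf K (random_edges V)) Q"
    and half: "measure_pmf.prob (poisson_pmf rate) {k. y < real k} \<le> 1 / 2"
  shows "1 - measure_pmf.prob Q U \<le> measure_pmf.prob K {k. real k \<le> y} +
    2 * (1 - measure_pmf.prob (bind_pmf (poisson_pmf rate) (random_edges V)) U)"
proof -
  define h where "h k = 1 - measure_pmf.prob (random_edges V k) U" for k
  define k0 where "k0 = nat \<lfloor>y\<rfloor>"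
  \<comment> \<open>A negative \<open>y\<close> would leave all Poisson mass above it; hence
    \<open>k0\<close> is the true floor of \<open>y\<close>.\<close>
  have y: "0 \<le> y"
  proof (rule ccontr)
    assume "\<not> 0 \<le> y"
    then have "{k. y < real k} = UNIV"
      by auto
    then show False
      using half by simp
  qed
  have h01: "0 \<le> h k" "h k \<le> 1" for k
    by (auto simp: h_def)
  have mono: "h l \<le> h k" if "k \<le> l" for k l
    using prob_mono_up_closed[OF rel_pmf_random_edges_mono[OF that, of V] U] by (simp add: h_def)
  have int: "integrable (measure_pmf M) h" for M
    using h01 by (intro measure_pmf.integrable_const_bound[where B = 1]) (auto intro!: AE_I2)
  have bind: "1 - measure_pmf.prob (bind_pmf M (random_edges V)) U = measure_pmf.expectation M h" for M
    unfolding prob_bind_pmf h_def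
    by (subst Bochner_Integration.integral_diff)
      (auto intro!: measure_pmf.integrable_const_bound[where B = 1])
  have "1 - measure_pmf.prob Q U \<le> measure_pmf.expectation K h"
    using prob_mono_up_closed[OF rel U] by (simp add: bind[symmetric])
  \<comment> \<open>Failure gets less likely with more edges: above \<open>y\<close> there are at
    least \<open>k0\<close> of them, and up to \<open>y\<close> failure is bounded by 1.\<close>
  also have "\<dots> \<le> measure_pmf.expectation K (\<lambda>k. indicator {k. real k \<le> y} k + h k0)"
  proof (rule integral_mono)
    fix k
    show "h k \<le> indicator {k. real k \<le> y} k + h k0"
    proof (cases "real k \<le> y")
      case False
      then have "k0 \<le> k"
        using y unfolding k0_def by linarith
      then show ?thesis
        using False mono by simp
    qed (use h01[of k] h01[of k0] in simp)
  qed (auto intro!: int Bochner_Integration.integrable_add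
      measure_pmf.integrable_const_bound[where f = "indicator _" and B = 1])
  also have "\<dots> = measure_pmf.prob K {k. real k \<le> y} + h k0"
    by (subst Bochner_Integration.integral_add)
      (auto intro!: measure_pmf.integrable_const_bound[where f = "indicator _" and B = 1])
  also have "h k0 \<le> 2 * measure_pmf.expectation (poisson_pmf rate) h"
  proof -
    have "{k. real k \<le> y} = UNIV - {k. y < real k}"
      by auto
    then have "1 / 2 \<le> measure_pmf.prob (poisson_pmf rate) {k. real k \<le> y}"
      using half measure_pmf.prob_compl[of "{k. y < real k}" "poisson_pmf rate"] by simp
    \<comment> \<open>At least half of the Poisson mass lies at values \<open>k \<le> k0\<close>,
      where \<open>h k\<close> is at least \<open>h k0\<close>.\<close>
    then have "h k0 * (1 / 2) \<le> h k0 * measure_pmf.prob (poisson_pmf rate) {k. real k \<le> y}"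
      using h01 by (intro mult_left_mono)
    also have "\<dots> = measure_pmf.expectation (poisson_pmf rate) (\<lambda>k. h k0 * indicator {k. real k \<le> y} k)"
      by simp
    also have "\<dots> \<le> measure_pmf.expectation (poisson_pmf rate) h"
    proof (rule integral_mono)
      fix k
      show "h k0 * indicator {k. real k \<le> y} k \<le> h k"
      proof (cases "real k \<le> y")
        case True
        then have "k \<le> k0"
          unfolding k0_def by linarith
        then show ?thesis
          using True mono by simp
      qed (use h01 in simp)
    qed (auto intro!: int integrable_mult_right
        measure_pmf.integrable_const_bound[where f = "indicator _" and B = 1])
    finally show ?thesis
      by simp
  qed
  finally show ?thesis
    by (simp add: bind)
qed

subsection \<open>The two regimes\<close>

text \<open>The edge probability \<open>p_minus\<close> may be negative; the truncation then gives
  the empty graph, which every graph contains.\<close>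

lemma binomial_graph_le_0:
  assumes "finite V" "q \<le> 0"
  shows "binomial_graph V q = return_pmf {}"
proof -
  have "bernoulli_pmf q = return_pmf False"
  proof (rule pmf_eqI)
    fix b show "pmf (bernoulli_pmf q) b = pmf (return_pmf False) b"
      using assms(2) by (cases b) (simp_all add: bernoulli_pmf.rep_eq)
  qed
  then show ?thesis
    using assms(1) by (simp add: binomial_graph_def)
qed

text \<open>A graph on \<open>V\<close> that contains a member of \<open>A\<close> lies in
  \<open>A\<close>, so the upward closure adds only sets outside the support.\<close>

lemma prob_up_closure:
  assumes "set_pmf Q \<subseteq> graphs_on V" "increasing_property V A"
  shows "measure_pmf.prob Q {T. \<exists>S\<in>A. S \<subseteq> T} = measure_pmf.prob Q A"
proof (rule measure_prob_cong_0)
  fix T assume "T \<in> {T. \<exists>S\<in>A. S \<subseteq> T} - A"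
  then have "T \<notin> set_pmf Q"
    using assms unfolding increasing_property_def by blast
  then show "pmf Q T = 0"
    by (simp add: set_pmf_iff)
qed auto

lemma set_pmf_random_intersection_graph: "set_pmf (random_intersection_graph V W p) \<subseteq> graphs_on V"
  by (auto simp: random_intersection_graph_def intersection_graph_def graphs_on_def all_edges_def)

lemma map_pmf_eq_bernoulli: "map_pmf P M = bernoulli_pmf (measure_pmf.prob M {x. P x})"
proof (rule pmf_eqI)
  fix b
  have "{x. \<not> P x} = UNIV - {x. P x}"
    by auto
  then show "pmf (map_pmf P M) b = pmf (bernoulli_pmf (measure_pmf.prob M {x. P x})) b"
    using measure_pmf.prob_compl[of "{x. P x}" M]
    by (cases b) (simp_all add: pmf_map vimage_def)
qed

text \<open>The lower bound keeps only the value 2 and uses Bernoulli's inequality; the upper bounds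
  come from \<open>q \<le> P(x \<ge> 1) \<le> n * p\<close> and meet the hypothesis of
  \<open>pmf_binomial_le_poisson\<close>.\<close>

lemma prob_binomial_ge_2:
  assumes n: "2 \<le> n" and p: "0 < p" "real n * p \<le> 1 / 2"
  defines "q \<equiv> measure_pmf.prob (binomial_pmf n p) {x. 2 \<le> x}"
  shows "real (n choose 2) * p\<^sup>2 * (1 - (real n - 2) * p) \<le> q" "0 < q" "q \<le> 1 / 2"
proof -
  have "1 * p \<le> real n * p"
    using n p by (intro mult_right_mono) auto
  then have p1: "p < 1"
    using p by linarith
  have "pmf (binomial_pmf n p) 2 \<le> q"
    unfolding q_def measure_pmf_single[symmetric] by (intro measure_pmf.finite_measure_mono) auto
  then have q: "real (n choose 2) * p\<^sup>2 * (1 - p) ^ (n - 2) \<le> q"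
    using p p1 by simp
  have "1 + real (n - 2) * (- p) \<le> (1 + (- p)) ^ (n - 2)"
    using p1 by (intro Bernoulli_inequality) simp
  then have "real (n choose 2) * p\<^sup>2 * (1 - (real n - 2) * p) \<le> real (n choose 2) * p\<^sup>2 * (1 - p) ^ (n - 2)"
    using n by (intro mult_left_mono) (auto simp: of_nat_diff)
  then show "real (n choose 2) * p\<^sup>2 * (1 - (real n - 2) * p) \<le> q"
    using q by linarith
  have "0 < real (n choose 2) * p\<^sup>2 * (1 - p) ^ (n - 2)"
    using n p p1 by (simp add: zero_less_binomial_iff)
  then show "0 < q"
    using q by linarith
  have "q \<le> measure_pmf.prob (binomial_pmf n p) (UNIV - {0})"
    unfolding q_def by (intro measure_pmf.finite_measure_mono) auto
  also have "\<dots> = 1 - (1 + (- p)) ^ n"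
    using measure_pmf.prob_compl[of "{0}" "binomial_pmf n p"] p p1 by (simp add: measure_pmf_single)
  also have "\<dots> \<le> real n * p"
    using Bernoulli_inequality[of "- p" n] p1 by simp
  finally show "q \<le> 1 / 2"
    using p by linarith
qed

lemma prob_binomial_graph_mono:
  assumes "finite V" "0 \<le> q" "q \<le> q'" "q' \<le> 1" "up_closed U"
  shows "measure_pmf.prob (binomial_graph V q) U \<le> measure_pmf.prob (binomial_graph V q') U"
  using assms by (intro prob_mono_up_closed rel_pmf_binomial_graph_mono)

text \<open>One edge is kept for each feature chosen at least twice. The number of these features is
  binomial, and replacing it by a Poisson number costs the factor 8.\<close>

lemma prob_random_intersection_graph_small_degree:
  assumes V: "finite V" "2 \<le> card V" and W: "finite W" and U: "up_closed U"
    and p: "0 \<le> p" "real (card V) * p \<le> 1 / 2"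
    and pm: "pm = real (card W) * p\<^sup>2 * (1 - (real (card V) - 2) * p - real (card W) * p\<^sup>2 / 2)"
  shows "1 - measure_pmf.prob (random_intersection_graph V W p) U \<le>
         8 * (1 - measure_pmf.prob (binomial_graph V pm) U)"
proof (cases "0 < pm")
  case False
  then have "rel_pmf (\<subseteq>) (binomial_graph V pm) (random_intersection_graph V W p)"
    using V by (simp add: binomial_graph_le_0 rel_pmf_return_pmf1)
  then have "measure_pmf.prob (binomial_graph V pm) U \<le> measure_pmf.prob (random_intersection_graph V W p) U"
    using U by (rule prob_mono_up_closed)
  then have "1 - measure_pmf.prob (random_intersection_graph V W p) U \<le>
      1 * (1 - measure_pmf.prob (binomial_graph V pm) U)"
    by simp
  also have "\<dots> \<le> 8 * (1 - measure_pmf.prob (binomial_graph V pm) U)"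
    by (rule mult_right_mono) auto
  finally show ?thesis .
next
  case True
  let ?n = "card V" and ?m = "card W" and ?N = "card V choose 2"
  have p0: "0 < p" and m: "1 \<le> ?m"
    using True p(1) unfolding pm by (auto intro: ccontr simp: not_less_eq_eq dest!: order_antisym)
  have "1 * p \<le> real ?n * p"
    using V p by (intro mult_right_mono) auto
  then have p01: "p \<in> {0..1}"
    using p by auto
  have N: "0 < real ?N"
    using V by (simp add: zero_less_binomial_iff)
  define q where "q = measure_pmf.prob (binomial_pmf ?n p) {x. 2 \<le> x}"
  note q = prob_binomial_ge_2[OF V(2) p0 p(2), folded q_def]
  define K where "K = map_pmf (\<lambda>x. of_bool (2 \<le> x) :: nat) (binomial_pmf ?n p)"
  have "K = map_pmf of_bool (map_pmf (\<lambda>x. 2 \<le> x) (binomial_pmf ?n p))"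
    by (simp add: K_def pmf.map_comp o_def)
  also have "\<dots> = map_pmf of_bool (bernoulli_pmf q)"
    by (simp only: map_pmf_eq_bernoulli q_def)
  finally have K: "iid_sum K ?m = binomial_pmf ?m q"
    using q by (simp add: binomial_pmf_eq_iid_sum)
  have "rel_pmf (\<subseteq>) (bind_pmf (binomial_pmf ?m q) (random_edges V)) (random_intersection_graph V W p)"
    unfolding K[symmetric] unfolding K_def
    by (rule rel_pmf_random_intersection_graph[OF V W p01]) auto
  then have "1 - measure_pmf.prob (random_intersection_graph V W p) U \<le>
      1 - measure_pmf.prob (bind_pmf (binomial_pmf ?m q) (random_edges V)) U"
    using prob_mono_up_closed[OF _ U] by fastforce
  \<comment> \<open>The comparison of weights is applied to the complement of
    \<open>U\<close>.\<close>
  also have "\<dots> \<le> 8 * (1 - measure_pmf.prob (bind_pmf (poisson_pmf (real ?m * q)) (random_edges V)) U)"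
    using prob_bind_pmf_le_if_pmf_le[of "binomial_pmf ?m q" 8 "poisson_pmf (real ?m * q)" "random_edges V" "UNIV - U"]
      pmf_binomial_le_poisson[OF q(2,3) m] measure_pmf.prob_compl[of U]
    by simp
  also have "\<dots> \<le> 8 * (1 - measure_pmf.prob (binomial_graph V pm) U)"
  proof -
    \<comment> \<open>A lower bound for the Poisson mean per edge, \<open>m * q / N\<close>;
      moreover \<open>pm\<close> is \<open>x\<close> minus half the square of
      \<open>m * p^2\<close>.\<close>
    define x where "x = real ?m * p\<^sup>2 * (1 - (real ?n - 2) * p)"
    have b: "0 \<le> 1 - (real ?n - 2) * p" "1 - (real ?n - 2) * p \<le> 1"
    proof -
      have "0 \<le> (real ?n - 2) * p"
        using V p by simp
      then show "0 \<le> 1 - (real ?n - 2) * p" "1 - (real ?n - 2) * p \<le> 1"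
        using p left_diff_distrib[of "real ?n" 2 p] by linarith+
    qed
    have x: "0 \<le> x" "x \<le> real ?m * p\<^sup>2"
      unfolding x_def using b by (auto intro: mult_left_le)
    have "x\<^sup>2 \<le> (real ?m * p\<^sup>2)\<^sup>2"
      using x by (intro power_mono)
    then have "pm \<le> x - x\<^sup>2 / 2"
      by (simp add: pm x_def algebra_simps power2_eq_square)
    also have "\<dots> \<le> 1 - exp (- x)"
      using exp_minus_le_quadratic[OF x(1)] by simp
    also have "\<dots> \<le> 1 - exp (- (real ?m * q) / real ?N)"
    proof -
      have "real ?m * (real ?N * p\<^sup>2 * (1 - (real ?n - 2) * p)) \<le> real ?m * q"
        using q(1) by (intro mult_left_mono) auto
      then have "x \<le> real ?m * q / real ?N"
        using N by (simp add: x_def field_simps)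
      then show ?thesis
        by simp
    qed
    finally have "measure_pmf.prob (binomial_graph V pm) U \<le>
        measure_pmf.prob (binomial_graph V (1 - exp (- (real ?m * q) / real ?N))) U"
      using V U True by (intro prob_binomial_graph_mono) auto
    then show ?thesis
      using q m V by (simp add: poisson_random_edges)
  qed
  finally show ?thesis .
qed

text \<open>\<open>R\<close> is the scale of the fluctuations. The number of available edges has
  mean at least \<open>(R^2 - m) / 2\<close>, whereas the Poisson mean is at most
  \<open>(R^2 - w * R - 2 * m) / 2\<close>; a threshold \<open>y\<close> between them separates the
  two.\<close>

lemma prob_random_intersection_graph_large_degree:
  assumes V: "finite V" "2 \<le> card V" and W: "finite W" and U: "up_closed U"
    and p: "0 < p" "p \<le> 1"
    and R: "R = sqrt (real (card W) * real (card V) * p)" "1 \<le> R"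
    and w: "6 \<le> w" and b: "b = 1 - w / R - 2 / (real (card V) * p)" "0 < b"
    and pm: "pm = real (card W) * p / real (card V) * (b - real (card W) * p / (2 * real (card V)))"
  shows "1 - measure_pmf.prob (random_intersection_graph V W p) U \<le>
         exp (1 / 2 - w / 2) + 2 * (1 - measure_pmf.prob (binomial_graph V pm) U)"
proof -
  let ?N = "card V choose 2"
  define n m where "n = real (card V)" and "m = real (card W)"
  have n: "2 \<le> n"
    using V by (simp add: n_def)
  have R2: "R\<^sup>2 = m * n * p"
    using p by (simp add: R n_def m_def)
  have m: "0 < m"
    using R2 R(2) n p by (cases "m = 0") (auto simp: m_def)
  have N: "real ?N = n * (n - 1) / 2"
  proof -
    have "2 dvd card V * (card V - 1)"
      by (cases "even (card V)") auto
    then have "real ?N = real (card V * (card V - 1)) / 2"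
      by (simp only: choose_two real_of_nat_div of_nat_numeral)
    then show ?thesis
      using V by (simp add: n_def of_nat_diff)
  qed
  define x where "x = m * p / n * b"
  have mpn: "0 < m * p / n"
    using m p n by simp
  have x: "0 < x"
    unfolding x_def using mpn b(2) by (rule mult_pos_pos)
  have b1: "b \<le> 1"
  proof -
    have "0 \<le> w / R" "0 \<le> 2 / (real (card V) * p)"
      using w R(2) p by auto
    then show ?thesis
      using b(1) by linarith
  qed
  define rate where "rate = real ?N * x"
  have rate0: "0 < rate"
    using V x by (simp add: rate_def zero_less_binomial_iff)
  have "rate = (n - 1) / n * (m * n * p * b / 2)"
    unfolding rate_def N x_def using n by (simp add: field_simps)
  also have "\<dots> \<le> 1 * (m * n * p * b / 2)"
    using n m p b by (intro mult_right_mono) auto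
  \<comment> \<open>The three terms of \<open>b\<close> give \<open>R^2\<close>, the gap
    \<open>w * R\<close> and the allowance \<open>2 * m\<close> for rounding in
    \<open>x div 2\<close>.\<close>
  also have "m * n * p * b = R\<^sup>2 - w * R - 2 * m"
  proof -
    have "m * n * p * b = R\<^sup>2 - R\<^sup>2 * (w / R) - m * n * p * (2 / (n * p))"
      unfolding b(1) R2 n_def[symmetric] by (simp add: algebra_simps)
    then show ?thesis
      using R(2) n p by (simp add: power2_eq_square)
  qed
  finally have rate: "rate \<le> (R\<^sup>2 - w * R - 2 * m) / 2"
    by simp
  \<comment> \<open>This is \<open>w * R / 4\<close> below \<open>(R^2 - m) / 2\<close> and at least
    as far above \<open>rate\<close>.\<close>
  define y where "y = (R\<^sup>2 - m - w * R / 2) / 2"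
  \<comment> \<open>At this parameter the quadratic terms in both exponents are bounded, while the
    gap contributes a negative multiple of \<open>w\<close>.\<close>
  define t where "t = 1 / R"
  have t: "0 \<le> t" "t \<le> 1" "t * R = 1" "t\<^sup>2 * R\<^sup>2 = 1"
    using R(2) by (auto simp: t_def power_divide)
  have half: "measure_pmf.prob (poisson_pmf rate) {k. y < real k} \<le> 1 / 2"
  proof -
    have "measure_pmf.prob (poisson_pmf rate) {k. y < real k} \<le> exp (rate * (t + t\<^sup>2) - t * y)"
      using rate0 t by (intro prob_poisson_gt_le) auto
    \<comment> \<open>The exponent is at most \<open>1/2 - w/4\<close>, and
      \<open>w \<ge> 6\<close>.\<close>
    also have "rate * (t + t\<^sup>2) - t * y \<le> - 1"
    proof -
      have "0 \<le> w * R"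
        using w R(2) by simp
      then have "rate \<le> R\<^sup>2 / 2"
        using rate m by argo
      then have "rate * t\<^sup>2 \<le> R\<^sup>2 / 2 * t\<^sup>2"
        by (intro mult_right_mono) auto
      moreover have "t * (rate - y) \<le> t * (- w * R / 4)"
        using rate m t by (intro mult_left_mono) (auto simp: y_def field_simps)
      moreover have "t * (- w * R / 4) = - w / 4"
        using t(3) by (simp add: algebra_simps)
      moreover have "R\<^sup>2 / 2 * t\<^sup>2 = 1 / 2"
        using t(4) by (simp add: mult.commute)
      moreover have "rate * (t + t\<^sup>2) - t * y = rate * t\<^sup>2 + t * (rate - y)"
        by (simp add: algebra_simps)
      ultimately show ?thesis
        using w by linarith
    qed
    also have "exp (- 1 :: real) \<le> 1 / 2"
      using exp_ge_add_one_self[of "1 :: real"] by (simp add: exp_minus field_simps)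
    finally show ?thesis
      by simp
  qed
  let ?K = "iid_sum (map_pmf (\<lambda>x. x div 2) (binomial_pmf (card V) p)) (card W)"
  have fail: "1 - measure_pmf.prob (random_intersection_graph V W p) U \<le>
      measure_pmf.prob ?K {k. real k \<le> y} +
      2 * (1 - measure_pmf.prob (bind_pmf (poisson_pmf rate) (random_edges V)) U)"
    using p by (intro failure_prob_le_poisson_random_edges V U rate0 half rel_pmf_random_intersection_graph W) auto
  have lower: "measure_pmf.prob ?K {k. real k \<le> y} \<le> exp (1 / 2 - w / 2)"
  proof -
    have "measure_pmf.prob ?K {k. real k \<le> y} \<le> exp (2 * t * y + m * (t - n * p * (t - t\<^sup>2 / 2)))"
      unfolding m_def n_def using p t by (intro prob_iid_sum_half_binomial_le) auto
    also have "2 * t * y + m * (t - n * p * (t - t\<^sup>2 / 2)) =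
        2 * t * y + m * t - m * n * p * t + m * n * p * t\<^sup>2 / 2"
      by (simp add: algebra_simps)
    \<comment> \<open>The rounding loss \<open>m * t\<close> and the main term
      \<open>R^2 * t\<close> cancel against \<open>2 * t * y\<close>.\<close>
    also have "\<dots> = t\<^sup>2 * R\<^sup>2 / 2 - t * R * w / 2"
      unfolding R2[symmetric] by (simp add: y_def field_simps)
    also have "\<dots> = 1 / 2 - w / 2"
      using t by simp
    finally show ?thesis .
  qed
  have poisson: "bind_pmf (poisson_pmf rate) (random_edges V) = binomial_graph V (1 - exp (- x))"
    using V rate0 poisson_random_edges[OF V rate0] by (simp add: rate_def zero_less_binomial_iff)
  have "measure_pmf.prob (binomial_graph V pm) U \<le> measure_pmf.prob (binomial_graph V (1 - exp (- x))) U"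
  proof (cases "0 \<le> pm")
    case True
    have "x \<le> m * p / n"
      unfolding x_def using mpn b1 by (intro mult_left_le) auto
    then have "x\<^sup>2 \<le> (m * p / n)\<^sup>2"
      using x by (intro power_mono) auto
    then have "pm \<le> x - x\<^sup>2 / 2"
      unfolding pm x_def n_def[symmetric] m_def[symmetric] by (simp add: algebra_simps power2_eq_square)
    also have "\<dots> \<le> 1 - exp (- x)"
      using exp_minus_le_quadratic[of x] x by simp
    finally show ?thesis
      using True V U by (intro prob_binomial_graph_mono) auto
  next
    case False
    then have "rel_pmf (\<subseteq>) (binomial_graph V pm) (binomial_graph V (1 - exp (- x)))"
      using V by (simp add: binomial_graph_le_0 rel_pmf_return_pmf1)
    then show ?thesis
      using U by (rule prob_mono_up_closed)
  qed
  moreover have "1 - r \<le> e + 2 * (1 - a)" if "a \<le> b" "1 - r \<le> k + 2 * (1 - b)" "k \<le> e"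
    for a b e k r :: real
    using that by argo
  ultimately show ?thesis
    using fail lower unfolding poisson by blast
qed

section \<open>Passage to the limit in both regimes\<close>

theorem lemma3:
  fixes \<alpha> :: real and m :: "nat \<Rightarrow> nat" and p \<omega> p_minus :: "nat \<Rightarrow> real"
    and V :: "nat \<Rightarrow> 'v set" and W :: "nat \<Rightarrow> 'w set"
    and A :: "nat \<Rightarrow> 'v set set set"
  assumes "\<alpha> > 0"
    and "\<And>n. \<bar>real (m n) - real n powr \<alpha>\<bar> < 1"
    and "\<And>n. finite (V n)" and "\<And>n. card (V n) = n"
    and "\<And>n. finite (W n)" and "\<And>n. card (W n) = m n"
    and "\<And>n. 0 \<le> p n" and "\<And>n. p n \<le> 1"
    and "\<And>n. real (m n) * (p n)\<^sup>2 < 1"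
    and "\<And>n. increasing_property (V n) (A n)"
    and "(\<lambda>n. real n * p n) \<in> o(\<lambda>_. 1) \<and>
         (\<forall>n. p_minus n =
            real (m n) * (p n)\<^sup>2 *
              (1 - (real n - 2) * p n - real (m n) * (p n)\<^sup>2 / 2))
       \<or> filterlim (\<lambda>n. real n * p n) at_top sequentially \<and>
         filterlim \<omega> at_top sequentially \<and>
         \<omega> \<in> o(\<lambda>n. sqrt (real (m n) * real n * p n)) \<and>
         (\<forall>n. p_minus n =
            real (m n) * p n / real n *
              (1 - \<omega> n / sqrt (real (m n) * real n * p n)
                 - 2 / (real n * p n) - real (m n) * p n / (2 * real n)))"
    and "(\<lambda>n. measure_pmf.prob (binomial_graph (V n) (p_minus n)) (A n)) \<longlonglongrightarrow> 1"
  shows "(\<lambda>n. measure_pmf.prob (random_intersection_graph (V n) (W n) (p n)) (A n)) \<longlonglongrightarrow> 1"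
proof -
  define U where "U n = {T. \<exists>S\<in>A n. S \<subseteq> T}" for n
  define P where "P n = measure_pmf.prob (binomial_graph (V n) (p_minus n)) (A n)" for n
  define Q where "Q n = measure_pmf.prob (random_intersection_graph (V n) (W n) (p n)) (A n)" for n
  have U: "up_closed (U n)" for n
    by (auto simp: up_closed_def U_def)
  have P: "P n = measure_pmf.prob (binomial_graph (V n) (p_minus n)) (U n)" for n
    unfolding P_def U_def using set_pmf_binomial_graph assms(10)
    by (subst prob_up_closure) (auto simp: graphs_on_def)
  have Q: "Q n = measure_pmf.prob (random_intersection_graph (V n) (W n) (p n)) (U n)" for n
    unfolding Q_def U_def using set_pmf_random_intersection_graph assms(10)
    by (subst prob_up_closure) auto
  have P1: "P n \<le> 1" for n
    by (simp add: P_def)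
  have "P \<longlonglongrightarrow> 1"
    using assms(12) unfolding P_def .
  then have lim0: "(\<lambda>n. c * (1 - P n)) \<longlonglongrightarrow> 0" for c
    by (auto intro!: tendsto_eq_intros)
  \<comment> \<open>Both regimes reduce to a null sequence bounding the failure probability.\<close>
  have "\<exists>e. e \<longlonglongrightarrow> 0 \<and> (\<forall>\<^sub>F n in sequentially. 1 - Q n \<le> e n)"
    using assms(11)
  proof (elim disjE conjE)
    assume np: "(\<lambda>n. real n * p n) \<in> o(\<lambda>_. 1)"
      and pm: "\<forall>n. p_minus n = real (m n) * (p n)\<^sup>2 *
        (1 - (real n - 2) * p n - real (m n) * (p n)\<^sup>2 / 2)"
    have "\<forall>\<^sub>F n in sequentially. norm (real n * p n) \<le> 1 / 2 * norm (1 :: real)"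
      using np by (rule landau_o.smallD) simp
    then have "\<forall>\<^sub>F n in sequentially. 1 - Q n \<le> 8 * (1 - P n)"
      using eventually_ge_at_top[of 2]
    proof eventually_elim
      case (elim n)
      then show ?case
        unfolding P Q using assms pm[rule_format, of n]
        by (intro prob_random_intersection_graph_small_degree U) auto
    qed
    then show ?thesis
      using lim0[of 8] by blast
  next
    assume np: "filterlim (\<lambda>n. real n * p n) at_top sequentially"
      and w: "filterlim \<omega> at_top sequentially" "\<omega> \<in> o(\<lambda>n. sqrt (real (m n) * real n * p n))"
      and pm: "\<forall>n. p_minus n = real (m n) * p n / real n *
        (1 - \<omega> n / sqrt (real (m n) * real n * p n)
           - 2 / (real n * p n) - real (m n) * p n / (2 * real n))"
    let ?R = "\<lambda>n. sqrt (real (m n) * real n * p n)"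
    \<comment> \<open>The constants \<open>1/2\<close> here and \<open>8\<close> below give
      \<open>b \<ge> 1/4\<close>; with \<open>\<omega> n \<ge> 6\<close> also
      \<open>?R n \<ge> 1\<close> follows.\<close>
    have "\<forall>\<^sub>F n in sequentially. norm (\<omega> n) \<le> 1 / 2 * norm (?R n)"
      using w(2) by (rule landau_o.smallD) simp
    moreover have "\<forall>\<^sub>F n in sequentially. 6 \<le> \<omega> n"
      using w(1) by (auto simp: filterlim_at_top)
    moreover have "\<forall>\<^sub>F n in sequentially. 8 \<le> real n * p n"
      using np by (auto simp: filterlim_at_top)
    ultimately have "\<forall>\<^sub>F n in sequentially. 1 - Q n \<le> exp (1 / 2 - \<omega> n / 2) + 2 * (1 - P n)"
      using eventually_ge_at_top[of 2]
    proof eventually_elim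
      case (elim n)
      have "0 \<le> ?R n"
        using assms(7)[of n] by simp
      then have R: "1 \<le> ?R n" "2 * \<omega> n \<le> ?R n"
        using elim(1,2) by (simp_all only: real_norm_def)
      have p: "0 < p n"
        using elim assms(7)[of n] by (cases "p n = 0") auto
      have "\<omega> n / ?R n \<le> 1 / 2" "2 / (real n * p n) \<le> 1 / 4"
        using R elim p by (simp_all add: divide_simps)
      then have b: "0 < 1 - \<omega> n / ?R n - 2 / (real n * p n)"
        by linarith
      show ?case
        unfolding P Q using assms(3,4,5,6,8) pm[rule_format, of n] p R elim b
        by (intro prob_random_intersection_graph_large_degree[OF _ _ _ U, where R = "?R n" and
            b = "1 - \<omega> n / ?R n - 2 / (real n * p n)"]) auto
    qed
    moreover have "(\<lambda>n. exp (1 / 2 - \<omega> n / 2)) \<longlonglongrightarrow> 0"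
    proof (rule filterlim_compose[OF exp_at_bot])
      show "filterlim (\<lambda>n. 1 / 2 - \<omega> n / 2) at_bot sequentially"
        unfolding filterlim_at_bot
      proof
        fix Z :: real
        have "\<forall>\<^sub>F n in sequentially. 1 - 2 * Z \<le> \<omega> n"
          using w(1) by (auto simp: filterlim_at_top)
        then show "\<forall>\<^sub>F n in sequentially. 1 / 2 - \<omega> n / 2 \<le> Z"
          by eventually_elim linarith
      qed
    qed
    then have "(\<lambda>n. exp (1 / 2 - \<omega> n / 2) + 2 * (1 - P n)) \<longlonglongrightarrow> 0 + 0"
      using lim0 by (rule tendsto_add)
    ultimately show ?thesis
      by (auto intro!: exI[of _ "\<lambda>n. exp (1 / 2 - \<omega> n / 2) + 2 * (1 - P n)"])
  qed
  then obtain e where e: "e \<longlonglongrightarrow> 0" "\<forall>\<^sub>F n in sequentially. 1 - Q n \<le> e n"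
    by blast
  have "Q \<longlonglongrightarrow> 1"
  proof (rule tendsto_sandwich)
    show "\<forall>\<^sub>F n in sequentially. 1 - e n \<le> Q n"
      using e(2) by eventually_elim linarith
    show "\<forall>\<^sub>F n in sequentially. Q n \<le> 1"
      by (simp add: Q_def)
    show "(\<lambda>n. 1 - e n) \<longlonglongrightarrow> 1"
      using e(1) by (auto intro!: tendsto_eq_intros)
  qed simp
  then show ?thesis
    unfolding Q_def .
qed

end
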